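(* Let $(X,d,m)$ be a complete and separable metric measure space such that $X=\operatorname{supp}(m)$ and $(X,d)$ is a geodesic space. Let $\mu_0,\mu_1\in\mathcal{P}_2(X)$, let $[0,1]\ni\tau\mapsto\mu_\tau\in\mathcal{P}_2(X)$ be a geodesic of $(\mathcal{P}_2(X),W_2)$ connecting $\mu_0$ to $\mu_1$, and let $\boldsymbol{\gamma}\in\mathcal{P}(\mathcal{G}(X))$ be the dynamical optimal plan associated to $(\mu_\tau)_{\tau\in[0,1]}$. Let $G\subset\mathcal{G}(X)$ be the support of $\boldsymbol{\gamma}$. Fix $t\in(0,1)$ and assume that there exist a positive constant $C$ and a neighborhood $U_t\subset[0,1]$ of $t$ such that for each $\tau\in U_t$ one has $\mu_\tau=\varrho_\tau m$ with $\varrho_\tau\le C$. For $\gamma\in G$ set $$I_t(\gamma):=\{\tau\in[0,1] : \gamma_\tau\in e_t(G)\}.$$ Then $$\lim_{\varepsilon\to 0}\frac{\mathcal{L}^1\big(I_t(\gamma)\cap(t-\varepsilon,t+\varepsilon)\big)}{2\varepsilon}=1\qquad\text{in } L^1(G,\boldsymbol{\gamma}),$$ that is, $$\lim_{\varepsilon\to0}\int_G\left|\frac{\mathcal{L}^1\big(I_t(\gamma)\cap(t-\varepsilon,t+\varepsilon)\big)}{2\varepsilon}-1\right|\,\boldsymbol{\gamma}(d\gamma)=0.$$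
   Context: Metric measure space: $(X,d)$ is a metric space and $m$ is a non-negative Borel measure on $X$; complete and separable refers to $(X,d)$. $\mathcal{P}_2(X)$ is the set of Borel probability measures on $X$ with finite second moment, with the $L^2$-Wasserstein distance $W_2$. Geodesics in a metric space are constant-speed minimizing geodesics parametrized on $[0,1]$: $d(\gamma_s,\gamma_r)=|s-r|\,d(\gamma_0,\gamma_1)$ for all $s,r\in[0,1]$. A geodesic space is one in which any two points are joined by such a geodesic. $\mathcal{G}(X)\subset C([0,1];X)$ is the set of geodesics of $(X,d)$, with the uniform topology, and $\mathcal{P}(\mathcal{G}(X))$ is the set of Borel probability measures on it. For $\tau\in[0,1]$, $e_\tau:C([0,1];X)\to X$, $e_\tau(\gamma):=\gamma_\tau$, is the evaluation map; $e_\tau(G)$ is the image of $G$. A dynamical optimal plan associated to the geodesic $(\mu_\tau)$ is a measure $\boldsymbol{\gamma}\in\mathcal{P}(\mathcal{G}(X))$ with $(e_\tau)_\sharp\boldsymbol{\gamma}=\mu_\tau$ for all $\tau\in[0,1]$ and such that $(e_0,e_1)_\sharp\boldsymbol{\gamma}$ is an optimal coupling of $\mu_0$ and $\mu_1$ for the cost $d^2$. $\mathcal{L}^1$ denotes one-dimensional Lebesgue measure. The bound $\varrho_\tau\le C$ is understood $m$-almost everywhere.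
   Formalization: The measure m is additionally assumed finite on compact sets; for an arbitrary non-negative Borel measure the claim fails (e.g. in the sup-norm plane with m = length on the line y=0 plus the measure of density 1/|y|). *)

theory Defs
  imports "HOL-Probability.Probability"
begin

text \<open>
  Conventions.  The space \<open>X\<close> is a type of class \<^class>\<open>polish_space\<close>, i.e. the given
  metric is complete and separable.  A Borel measure on \<open>X\<close> is understood to be finite on compact
  sets (it need not be finite, nor finite on bounded sets); this is stated as a separate
  hypothesis where it is used.  Some such convention is indispensable: take the plane with the
  sup norm, \<open>m = \<L>\<^sup>1\<close> on the line \<open>y = 0\<close> plus the measure of density \<open>1/|y|\<close>, and the
  curves \<open>\<tau> \<mapsto> (h + \<tau>, s(\<tau> - t))\<close> with \<open>(h,s)\<close> uniform in \<open>[0,1] \<times> [-1,1]\<close>.  All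
  densities are bounded by 1, yet a curve with \<open>s \<noteq> 0\<close> meets \<open>e\<^sub>t(G)\<close> only at time \<open>t\<close>.
\<close>

text \<open>Support of a Borel measure: the points all of whose open neighbourhoods have positive measure.\<close>

definition msupport :: "'b topology \<Rightarrow> 'b measure \<Rightarrow> 'b set" where
  "msupport T M = {x \<in> topspace T. \<forall>V. openin T V \<and> x \<in> V \<longrightarrow> emeasure M V > 0}"

definition borel_prob_measures :: "'b topology \<Rightarrow> 'b measure set" where
  "borel_prob_measures T =
     {M. prob_space M \<and> space M = topspace T \<and> sets M = sigma_sets (topspace T) {V. openin T V}}"

text \<open>
  Constant-speed minimizing geodesics on \<open>[0,1]\<close>, for a distance function \<open>d\<close> on a set \<open>S\<close>.
  Used both for \<open>X\<close> itself and for the Wasserstein space.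
\<close>

definition geodesic_in :: "'b set \<Rightarrow> ('b \<Rightarrow> 'b \<Rightarrow> real) \<Rightarrow> (real \<Rightarrow> 'b) \<Rightarrow> bool" where
  "geodesic_in S d c \<longleftrightarrow>
     (\<forall>s\<in>{0..1}. c s \<in> S) \<and>
     (\<forall>s\<in>{0..1}. \<forall>r\<in>{0..1}. d (c s) (c r) = \<bar>s - r\<bar> * d (c 0) (c 1))"

definition geodesic_space :: "'b set \<Rightarrow> ('b \<Rightarrow> 'b \<Rightarrow> real) \<Rightarrow> bool" where
  "geodesic_space S d \<longleftrightarrow>
     (\<forall>x\<in>S. \<forall>y\<in>S. \<exists>c. geodesic_in S d c \<and> c 0 = x \<and> c 1 = y)"

text \<open>
  \<open>C([0,1];X)\<close> with the uniform metric.  Its elements are functions on \<open>real\<close> that are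
  continuous on \<open>{0..1}\<close> and \<open>undefined\<close> outside, so curves are determined by their
  values on \<open>[0,1]\<close>.
\<close>

definition path_metric :: "(real \<Rightarrow> 'a::metric_space) metric" where
  "path_metric = cfunspace (top_of_set {0..1}) euclidean_metric"

definition geodesics :: "(real \<Rightarrow> 'a::metric_space) set" where
  "geodesics = {c \<in> mspace path_metric. geodesic_in UNIV dist c}"

definition geodesics_topology :: "(real \<Rightarrow> 'a::metric_space) topology" where
  "geodesics_topology = subtopology (mtopology_of path_metric) geodesics"

definition evl :: "real \<Rightarrow> (real \<Rightarrow> 'a) \<Rightarrow> 'a" where
  "evl \<tau> c = c \<tau>"

definition P2 :: "'a::metric_space measure set" where
  "P2 = {\<mu>. prob_space \<mu> \<and> sets \<mu> = sets borel \<and>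
           (\<exists>x0. (\<integral>\<^sup>+ x. ennreal ((dist x0 x)\<^sup>2) \<partial>\<mu>) < \<infinity>)}"

definition couplings :: "'a::metric_space measure \<Rightarrow> 'a measure \<Rightarrow> ('a \<times> 'a) measure set" where
  "couplings \<mu> \<nu> = {\<pi>. prob_space \<pi> \<and> sets \<pi> = sets borel \<and>
                       distr \<pi> borel fst = \<mu> \<and> distr \<pi> borel snd = \<nu>}"

definition transport_cost :: "('a::metric_space \<times> 'a) measure \<Rightarrow> ennreal" where
  "transport_cost \<pi> = (\<integral>\<^sup>+ z. ennreal ((dist (fst z) (snd z))\<^sup>2) \<partial>\<pi>)"

definition optimal_coupling ::
  "'a::metric_space measure \<Rightarrow> 'a measure \<Rightarrow> ('a \<times> 'a) measure \<Rightarrow> bool" where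
  "optimal_coupling \<mu> \<nu> \<pi> \<longleftrightarrow>
     \<pi> \<in> couplings \<mu> \<nu> \<and> (\<forall>\<pi>'\<in>couplings \<mu> \<nu>. transport_cost \<pi> \<le> transport_cost \<pi>')"

text \<open>On \<open>P2\<close> the infimum is finite, so no information is lost by \<^const>\<open>enn2real\<close>.\<close>

definition W2 :: "'a::metric_space measure \<Rightarrow> 'a measure \<Rightarrow> real" where
  "W2 \<mu> \<nu> = sqrt (enn2real (INF \<pi>\<in>couplings \<mu> \<nu>. transport_cost \<pi>))"

definition dynamical_optimal_plan ::
  "(real \<Rightarrow> 'a::metric_space measure) \<Rightarrow> (real \<Rightarrow> 'a) measure \<Rightarrow> bool" where
  "dynamical_optimal_plan \<mu> \<Gamma> \<longleftrightarrow>
     \<Gamma> \<in> borel_prob_measures geodesics_topology \<and>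
     (\<forall>\<tau>\<in>{0..1}. distr \<Gamma> borel (evl \<tau>) = \<mu> \<tau>) \<and>
     optimal_coupling (\<mu> 0) (\<mu> 1) (distr \<Gamma> borel (\<lambda>c. (evl 0 c, evl 1 c)))"

text \<open>
  The set \<open>I\<^sub>t(\<gamma>)\<close>.  Since \<open>e\<^sub>t(G)\<close> is in general only an analytic set,
  \<open>I\<^sub>t(\<gamma>)\<close> is Lebesgue measurable but need not be Borel, and its measure, as a function
  of \<open>\<gamma>\<close>, is universally measurable but need not be Borel.  It must therefore be measured
  by \<^const>\<open>lebesgue\<close> (not \<^const>\<open>lborel\<close>), and integrals over curves must be taken with
  respect to the completion of the plan.
\<close>

definition hit_times :: "real \<Rightarrow> (real \<Rightarrow> 'a) set \<Rightarrow> (real \<Rightarrow> 'a) \<Rightarrow> real set" where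
  "hit_times t G c = {\<tau> \<in> {0..1}. c \<tau> \<in> evl t ` G}"

end

theory Submission
  imports Defs
begin

text \<open>
  Put \<open>A = e\<^sub>t(G)\<close> and \<open>\<mu>\<^sub>s = (e\<^sub>s)\<^sub>\<sharp>\<Gamma>\<close>.  By Tonelli, once \<open>(t - \<epsilon>, t + \<epsilon>) \<subseteq> [0,1]\<close>, the integral in question
  equals \<open>1 - 1/(2\<epsilon>) \<integral> \<mu>\<^sub>s(A) ds\<close> over \<open>s \<in> (t - \<epsilon>, t + \<epsilon>)\<close>, so the theorem says that \<open>\<mu>\<^sub>s(A)\<close> tends
  to \<open>1\<close> in average as \<open>s \<rightarrow> t\<close>.  It does so even pointwise.  The plan is tight on \<open>G\<close>, so most of its mass
  sits near a compact \<open>H \<subseteq> G\<close>.  The tubes \<open>T\<^sub>\<eta> = {c(s) | c \<in> H, |s - t| \<le> \<eta>}\<close> are compact, hence of finite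
  \<open>m\<close>-measure, and they decrease to the compact set \<open>K = e\<^sub>t(H) \<subseteq> A\<close>, so \<open>m(T\<^sub>\<eta> - K) \<rightarrow> 0\<close>.  For
  \<open>|s - t| \<le> \<eta>\<close> the curves of \<open>H\<close> are in \<open>T\<^sub>\<eta>\<close> at time \<open>s\<close>, so \<open>\<mu>\<^sub>s(T\<^sub>\<eta>)\<close> is almost \<open>1\<close>, and the density
  bound gives \<open>\<mu>\<^sub>s(T\<^sub>\<eta> - K) \<le> C m(T\<^sub>\<eta> - K)\<close>.  Hence \<open>\<mu>\<^sub>s(A) \<ge> \<mu>\<^sub>s(K)\<close> is almost \<open>1\<close> as well
  (\<open>evaluation_image_mass_continuity\<close>).

  What remains is measurability.  The set \<open>A\<close> is only analytic.  Applied to the occupation measure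
  \<open>\<nu> = \<integral>\<^sub>0\<^sup>1 \<mu>\<^sub>s ds\<close>, universal measurability of analytic sets (\<open>continuous_image_sandwich\<close>) gives Borel sets
  \<open>B \<subseteq> A \<subseteq> B'\<close> with \<open>\<nu>(B' - B) = 0\<close>; then almost every curve spends no time in \<open>B' - B\<close>, and
  the times spent in \<open>A\<close> and in \<open>B\<close> have the same length (\<open>visit_times_sandwich\<close>).

  Both the tightness of the plan and the measurability of \<open>A\<close> come from one statement,
  Choquet's capacitability argument on a complete separable metric space (\<open>capacity_compact\<close>).  It applies to the
  space of geodesics since that space is closed in the complete space \<open>C([0,1];X)\<close>, and separable because the geodesics
  of bounded length are equi-Lipschitz.
\<close>

section \<open>Capacitability in complete separable metric spaces\<close>

context Metric_space begin

lemma separable_space_iff_dense: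
  "separable_space mtopology \<longleftrightarrow>
     (\<exists>D. countable D \<and> D \<subseteq> M \<and> (\<forall>x\<in>M. \<forall>r>0. \<exists>y\<in>D. d x y < r))"
proof -
  have "D \<subseteq> M \<Longrightarrow> mtopology closure_of D = topspace mtopology \<longleftrightarrow> (\<forall>x\<in>M. \<forall>r>0. \<exists>y\<in>D. d x y < r)" for D
    by (auto simp: metric_closure_of set_eq_iff subset_iff Bex_def)
  then show ?thesis
    unfolding separable_space_def by auto
qed

lemma separable_imp_second_countable:
  assumes "separable_space mtopology"
  shows "second_countable mtopology"
proof -
  obtain D where D: "countable D" "D \<subseteq> M" "\<And>x r. x \<in> M \<Longrightarrow> r > 0 \<Longrightarrow> \<exists>y\<in>D. d x y < r"
    using assms unfolding separable_space_iff_dense by blast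
  define \<B> where "\<B> = (\<lambda>(y, n::nat). mball y (1 / Suc n)) ` (D \<times> UNIV)"
  have "\<exists>V\<in>\<B>. x \<in> V \<and> V \<subseteq> W" if "openin mtopology W" "x \<in> W" for W x
  proof -
    obtain r where r: "r > 0" "mball x r \<subseteq> W" and x: "x \<in> M"
      using \<open>openin mtopology W\<close> \<open>x \<in> W\<close> unfolding openin_mtopology by blast
    obtain n :: nat where n: "1 / Suc n < r / 2"
      using r(1) by (meson half_gt_zero nat_approx_posE)
    obtain y where y: "y \<in> D" "d x y < 1 / Suc n"
      using D(3)[OF x, of "1 / Suc n"] by auto
    have "mball y (1 / Suc n) \<subseteq> mball x r"
    proof
      fix z assume z: "z \<in> mball y (1 / Suc n)"
      then have "d x z \<le> d x y + d y z"
        using x by (intro triangle) auto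
      then show "z \<in> mball x r"
        using z y n x by auto
    qed
    moreover have "x \<in> mball y (1 / Suc n)"
      using x y D(2) by (auto simp: commute)
    ultimately show ?thesis
      using y(1) r(2) unfolding \<B>_def by (force intro!: bexI[of _ "mball y (1 / Suc n)"])
  qed
  moreover have "countable \<B>" "\<forall>V\<in>\<B>. openin mtopology V"
    using D(1) by (auto simp: \<B>_def)
  ultimately show ?thesis
    unfolding second_countable_def by blast
qed

text \<open>
  Total boundedness with the centres anywhere in the space: each centre is moved to a point of \<open>S\<close> in its ball,
  at the cost of doubling the radius.
\<close>

lemma mtotally_bounded_finite_cover:
  assumes "S \<subseteq> M" and "\<And>e. e > 0 \<Longrightarrow> \<exists>F. finite F \<and> F \<subseteq> M \<and> S \<subseteq> (\<Union>x\<in>F. mball x e)"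
  shows "mtotally_bounded S"
  unfolding mtotally_bounded_def
proof (intro allI impI)
  fix e :: real assume "e > 0"
  then obtain F where F: "finite F" "F \<subseteq> M" "S \<subseteq> (\<Union>x\<in>F. mball x (e/2))"
    using assms(2)[of "e/2"] by auto
  define p where "p x = (SOME y. y \<in> S \<and> y \<in> mball x (e/2))" for x
  have p: "p x \<in> S \<and> p x \<in> mball x (e/2)" if "y \<in> S" "y \<in> mball x (e/2)" for x y
    using someI[of "\<lambda>y. y \<in> S \<and> y \<in> mball x (e/2)" y] that unfolding p_def by blast
  have "S \<subseteq> (\<Union>x\<in>p ` {x\<in>F. \<exists>y\<in>S. y \<in> mball x (e/2)}. mball x e)"
  proof
    fix y assume y: "y \<in> S"
    then obtain x where x: "x \<in> F" "y \<in> mball x (e/2)" using F(3) by auto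
    have px: "p x \<in> S" "p x \<in> mball x (e/2)" using p[OF y x(2)] by auto
    have "d (p x) y \<le> d (p x) x + d x y"
      using px x by (intro triangle) auto
    then have "y \<in> mball (p x) e"
      using px x by (auto simp: commute)
    then show "y \<in> (\<Union>x\<in>p ` {x\<in>F. \<exists>y\<in>S. y \<in> mball x (e/2)}. mball x e)"
      using x y by blast
  qed
  moreover have "p ` {x\<in>F. \<exists>y\<in>S. y \<in> mball x (e/2)} \<subseteq> S"
    using p by blast
  ultimately show "\<exists>K. finite K \<and> K \<subseteq> S \<and> S \<subseteq> (\<Union>x\<in>K. mball x e)"
    using F(1) by (intro exI[of _ "p ` {x\<in>F. \<exists>y\<in>S. y \<in> mball x (e/2)}"]) auto
qed

text \<open>
  For each scale \<open>1/(k+1)\<close> the space is an increasing union of finite unions of closed balls of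
  that radius, so continuity from below lets finitely many balls suffice without dropping to \<open>c\<close>.  Intersecting scale
  after scale gives closed sets \<open>C\<^sub>0 \<supseteq> C\<^sub>1 \<supseteq> \<dots>\<close> with \<open>\<phi>(C\<^sub>k) > c\<close>, whose intersection \<open>K\<close> is compact.
  By compactness every neighbourhood of \<open>K\<close> contains some \<open>C\<^sub>k\<close>.  The conclusion
  concerns neighbourhoods of \<open>K\<close> so as to cover outer measures of images, which are rarely continuous from above;
  outer regularity in the target space then takes over.
\<close>

proposition capacity_compact:
  fixes \<phi> :: "'a set \<Rightarrow> ennreal"
  assumes "mcomplete" "separable_space mtopology"
    and mono: "\<And>A B. A \<subseteq> B \<Longrightarrow> B \<subseteq> M \<Longrightarrow> \<phi> A \<le> \<phi> B"
    and SUP: "\<And>A :: nat \<Rightarrow> 'a set. incseq A \<Longrightarrow> (\<And>n. A n \<subseteq> M) \<Longrightarrow> \<phi> (\<Union>n. A n) = (SUP n. \<phi> (A n))"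
    and c: "c < \<phi> M"
  obtains K where "compactin mtopology K"
    and "\<And>V. openin mtopology V \<Longrightarrow> K \<subseteq> V \<Longrightarrow> c < \<phi> V"
proof (cases "M = {}")
  case True
  show ?thesis
  proof (rule that[of "{}"])
    fix V assume "openin mtopology V"
    then have "V = M" using True by (metis openin_subset topspace_mtopology subset_empty)
    then show "c < \<phi> V" using c by simp
  qed auto
next
  case False
  obtain D where D: "countable D" "D \<subseteq> M" "\<And>x r. x \<in> M \<Longrightarrow> r > 0 \<Longrightarrow> \<exists>y\<in>D. d x y < r"
    using \<open>separable_space mtopology\<close> unfolding separable_space_iff_dense by blast
  have "D \<noteq> {}" using False D(3)[of _ 1] by auto
  define x where "x = from_nat_into D"
  have x: "range x = D" using D(1) \<open>D \<noteq> {}\<close> by (simp add: x_def)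
  define U where "U k n = (\<Union>i\<in>{..n::nat}. mcball (x i) (1 / Suc k))" for k :: nat and n
  have closed_U: "closedin mtopology (U k n)" for k n
    unfolding U_def by (intro closedin_Union) auto
  have U_cover: "(\<Union>n. U k n) = M" for k
  proof
    show "(\<Union>n. U k n) \<subseteq> M" by (auto simp: U_def)
    show "M \<subseteq> (\<Union>n. U k n)"
    proof
      fix z assume z: "z \<in> M"
      then obtain y where "y \<in> D" "d z y < 1 / Suc k"
        using D(3)[of z "1 / Suc k"] by auto
      moreover then obtain i where "y = x i" using x by auto
      ultimately show "z \<in> (\<Union>n. U k n)"
        using z D(2) by (auto simp: U_def commute intro!: exI[of _ i] bexI[of _ i])
    qed
  qed
  have "\<exists>C. \<forall>k. (closedin mtopology (C k) \<and> c < \<phi> (C k)) \<and> (C (Suc k) \<subseteq> C k \<and> (\<exists>n. C (Suc k) \<subseteq> U k n))" (is "\<exists>C. ?P C")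
  proof (rule dependent_nat_choice)
    show "\<exists>S. closedin mtopology S \<and> c < \<phi> S" using c by (intro exI[of _ M]) auto
  next
    fix S and k :: nat assume S: "closedin mtopology S \<and> c < \<phi> S"
    then have "S \<subseteq> M" using closedin_subset by fastforce
    have "\<phi> S = \<phi> (\<Union>n. S \<inter> U k n)"
      using U_cover[of k] \<open>S \<subseteq> M\<close> by (intro arg_cong[of _ _ \<phi>]) auto
    also have "\<dots> = (SUP n. \<phi> (S \<inter> U k n))"
      using \<open>S \<subseteq> M\<close> unfolding U_def
      by (intro SUP incseq_SucI Int_mono order_refl UN_mono) auto
    finally obtain n where "c < \<phi> (S \<inter> U k n)"
      using S by (auto simp: less_SUP_iff)
    then show "\<exists>T. (closedin mtopology T \<and> c < \<phi> T) \<and> T \<subseteq> S \<and> (\<exists>n. T \<subseteq> U k n)"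
      using S closed_U by (intro exI[of _ "S \<inter> U k n"]) auto
  qed
  then obtain C where C: "\<And>k. closedin mtopology (C k)" "\<And>k. c < \<phi> (C k)"
     "\<And>k. C (Suc k) \<subseteq> C k" "\<And>k. \<exists>n. C (Suc k) \<subseteq> U k n" by blast
  have dec: "C j \<subseteq> C i" if "i \<le> j" for i j
    using lift_Suc_antimono_le[of C, OF C(3) that] .
  have CM: "C k \<subseteq> M" for k using C(1) closedin_subset by fastforce
  \<comment> \<open>applied to the intersection of the sets \<open>C k\<close> and to the range of a sequence with \<open>y k \<in> C k\<close>\<close>
  have tb: "mtotally_bounded S" if "S \<subseteq> M" and fin: "\<And>k. finite (S - C k)" for S
  proof (rule mtotally_bounded_finite_cover[OF \<open>S \<subseteq> M\<close>])
    fix e :: real assume "e > 0"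
    then obtain k where k: "1 / Suc k < e" by (meson nat_approx_posE)
    obtain n where n: "C (Suc k) \<subseteq> U k n" using C(4) by blast
    have "y \<in> (\<Union>z\<in>x ` {..n} \<union> (S - C (Suc k)). mball z e)" if "y \<in> S" for y
    proof (cases "y \<in> C (Suc k)")
      case True
      then obtain i where "i \<le> n" "y \<in> mcball (x i) (1 / Suc k)"
        using n by (auto simp: U_def)
      then show ?thesis using k by force
    next
      case False
      then show ?thesis using \<open>y \<in> S\<close> \<open>S \<subseteq> M\<close> \<open>e > 0\<close> by force
    qed
    then have "S \<subseteq> (\<Union>z\<in>x ` {..n} \<union> (S - C (Suc k)). mball z e)" by blast
    moreover have "x ` {..n} \<union> (S - C (Suc k)) \<subseteq> M" using x D(2) \<open>S \<subseteq> M\<close> by blast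
    ultimately show "\<exists>F. finite F \<and> F \<subseteq> M \<and> S \<subseteq> (\<Union>x\<in>F. mball x e)"
      using fin[of "Suc k"] by (meson finite_Un finite_atMost finite_imageI)
  qed
  define K where "K = (\<Inter>k. C k)"
  have "closedin mtopology K" unfolding K_def using C(1) by (intro closedin_Inter) auto
  moreover have "mtotally_bounded K"
    using CM by (intro tb) (auto simp: K_def Diff_eq_empty_iff[THEN iffD2, OF INT_lower])
  ultimately have "compactin mtopology K"
    using mtotally_bounded_eq_compact_closure_of[OF \<open>mcomplete\<close>, of K]
    by (simp add: closure_of_closedin)
  moreover have "c < \<phi> V" if V: "openin mtopology V" "K \<subseteq> V" for V
  proof -
    \<comment> \<open>otherwise pick \<open>y k \<in> C k - V\<close>; a limit point of \<open>y\<close> lies in every \<open>C k\<close>, hence in \<open>K \<subseteq> V\<close>\<close>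
    have "\<exists>k. C k \<subseteq> V"
    proof (rule ccontr)
      assume "\<nexists>k. C k \<subseteq> V"
      then have "\<forall>k. \<exists>y. y \<in> C k - V" by auto
      then obtain y where y: "\<And>k. y k \<in> C k - V" by metis
      have "finite (range y - C k)" for k
      proof (rule finite_subset)
        show "range y - C k \<subseteq> y ` {..<k}"
        proof
          fix z assume "z \<in> range y - C k"
          then obtain i where i: "z = y i" "y i \<notin> C k" by auto
          then have "i < k" using y[of i] dec[of k i] by (cases "i < k") auto
          then show "z \<in> y ` {..<k}" using i by simp
        qed
      qed auto
      then have "mtotally_bounded (range y)" using y CM by (intro tb) auto
      then obtain r where r: "strict_mono r" "MCauchy (y \<circ> r)"
        unfolding mtotally_bounded_sequentially by blast
      then obtain l where l: "limitin mtopology (y \<circ> r) l sequentially"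
        using \<open>mcomplete\<close> unfolding mcomplete_def by blast
      have "l \<in> C k" for k
      proof (rule limitin_closedin[OF l C(1)])
        have "(y \<circ> r) n \<in> C k" if "n \<ge> k" for n
          using y[of "r n"] dec[of k "r n"] seq_suble[OF r(1), of n] that by auto
        then show "eventually (\<lambda>n. (y \<circ> r) n \<in> C k) sequentially"
          by (auto simp: eventually_sequentially)
      qed auto
      then have "l \<in> V" using V by (auto simp: K_def)
      then have "eventually (\<lambda>n. (y \<circ> r) n \<in> V) sequentially"
        using l V(1) by (auto simp: limitin_def)
      then show False using y by (auto simp: eventually_sequentially)
    qed
    then obtain k where "C k \<subseteq> V" by blast
    then have "\<phi> (C k) \<le> \<phi> V" using V openin_subset by (intro mono) fastforce+
    with C(2)[of k] show ?thesis by order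
  qed
  ultimately show ?thesis using that by blast
qed

end

section \<open>Analytic sets are universally measurable\<close>

text \<open>
  Analytic sets are universally measurable.  The set function \<open>S \<mapsto> \<nu>\<^sup>*(f(S))\<close>, with \<open>\<nu>\<^sup>*\<close> the outer measure, is
  continuous from below on arbitrary sets, so capacitability gives a compact \<open>K\<close> such that every open \<open>W \<supseteq> f(K)\<close> has
  measure above a prescribed \<open>c < \<nu>\<^sup>*(f(M))\<close>.  Outer regularity gives \<open>\<nu>(f(K)) \<ge> c\<close>.  Thus the image has
  compact subsets of measure arbitrarily near its outer measure.
\<close>

lemma (in Metric_space) continuous_image_sandwich:
  fixes f :: "'a \<Rightarrow> 'b::polish_space"
  assumes "mcomplete" "separable_space mtopology" and f: "continuous_map mtopology euclidean f"
    and "finite_measure \<nu>" and sets_\<nu>: "sets \<nu> = sets borel"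
  obtains B B' where "B \<in> sets borel" "B' \<in> sets borel" "B \<subseteq> f ` M" "f ` M \<subseteq> B'" "B' - B \<in> null_sets \<nu>"
proof -
  interpret finite_measure \<nu> by fact
  have space_\<nu>: "space \<nu> = UNIV" using sets_eq_imp_space_eq[OF sets_\<nu>] by simp
  define \<K> where "\<K> = {K. compact K \<and> K \<subseteq> f ` M}"
  have K: "\<exists>K\<in>\<K>. c \<le> emeasure \<nu> K" if c: "c < outer_measure_of \<nu> (f ` M)" for c
  proof -
    define \<phi> where "\<phi> S = outer_measure_of \<nu> (f ` S)" for S
    obtain K where K: "compactin mtopology K"
      "\<And>V. openin mtopology V \<Longrightarrow> K \<subseteq> V \<Longrightarrow> c < \<phi> V"
    proof (rule capacity_compact[OF assms(1,2), where \<phi> = \<phi>])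
      show "c < \<phi> M" using c by (simp add: \<phi>_def)
      show "\<phi> A \<le> \<phi> B" if "A \<subseteq> B" for A B
        using that unfolding \<phi>_def by (intro outer_measure_of_mono image_mono)
      show "\<phi> (\<Union>n. A n) = (SUP n. \<phi> (A n))" if "incseq A" for A :: "nat \<Rightarrow> 'a set"
        unfolding \<phi>_def image_UN using that
        by (intro SUP_outer_measure_of_incseq[symmetric]) (auto simp: space_\<nu> incseq_def)
    qed blast
    have comp: "compact (f ` K)" using image_compactin[OF K(1) f] by simp
    have "c \<le> emeasure \<nu> W" if W: "f ` K \<subseteq> W" "open W" for W
    proof -
      have "openin mtopology {x \<in> topspace mtopology. f x \<in> W}"
        using f W(2) by (auto simp: continuous_map_def)
      moreover have "K \<subseteq> {x \<in> topspace mtopology. f x \<in> W}"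
        using W(1) compactin_subset_topspace[OF K(1)] by blast
      ultimately have "c < \<phi> {x \<in> topspace mtopology. f x \<in> W}" by (rule K(2))
      also have "\<dots> \<le> outer_measure_of \<nu> W"
        unfolding \<phi>_def by (intro outer_measure_of_mono) auto
      also have "\<dots> = emeasure \<nu> W" using W(2) by (simp add: sets_\<nu>)
      finally show ?thesis by simp
    qed
    then have "c \<le> (INF W\<in>{W. f ` K \<subseteq> W \<and> open W}. emeasure \<nu> W)"
      by (intro INF_greatest) auto
    also have "\<dots> = emeasure \<nu> (f ` K)"
      using comp by (intro outer_regular[symmetric] sets_\<nu>) (auto intro: borel_compact)
    finally show ?thesis
      using comp compactin_subset_topspace[OF K(1)] by (intro bexI[of _ "f ` K"]) (auto simp: \<K>_def)
  qed
  have "{} \<in> \<K>" by (simp add: \<K>_def)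
  then obtain k :: "nat \<Rightarrow> ennreal" where k: "range k \<subseteq> emeasure \<nu> ` \<K>" "(SUP K\<in>\<K>. emeasure \<nu> K) = (SUP n. k n)"
    using ennreal_SUP_countable_SUP[of \<K> "emeasure \<nu>"] by auto
  have "\<forall>n. \<exists>K. K \<in> \<K> \<and> k n = emeasure \<nu> K" using k(1) by blast
  then obtain S where S: "\<And>n. S n \<in> \<K>" "\<And>n. k n = emeasure \<nu> (S n)" by metis
  define B where "B = (\<Union>n. S n)"
  have B: "B \<in> sets borel" "B \<subseteq> f ` M"
  proof -
    have "S n \<in> sets borel" "S n \<subseteq> f ` M" for n
      using S(1)[of n] by (auto simp: \<K>_def borel_compact)
    then show "B \<in> sets borel" "B \<subseteq> f ` M" by (auto simp: B_def)
  qed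
  obtain B' where B': "B' \<in> sets \<nu>" "f ` M \<subseteq> B'" "outer_measure_of \<nu> (f ` M) = emeasure \<nu> B'"
    using outer_measure_of_attain[of "f ` M" \<nu>] space_\<nu> by auto
  have "emeasure \<nu> B' \<le> (SUP K\<in>\<K>. emeasure \<nu> K)"
    unfolding B'(3)[symmetric]
  proof (rule dense_le)
    fix c assume "c < outer_measure_of \<nu> (f ` M)"
    from K[OF this] show "c \<le> (SUP K\<in>\<K>. emeasure \<nu> K)" by (auto intro: SUP_upper2)
  qed
  also have "\<dots> \<le> emeasure \<nu> B"
    unfolding k(2) S(2) using B(1) by (intro SUP_least emeasure_mono) (auto simp: B_def sets_\<nu>)
  finally have "emeasure \<nu> (B' - B) = 0"
    using B B' sets_\<nu> by (subst emeasure_Diff) (auto simp: diff_eq_0_iff_ennreal less_top[symmetric])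
  then show ?thesis
    using B B' sets_\<nu> by (intro that[of B B']) auto
qed

section \<open>Borel probability measures on second countable spaces\<close>

lemma borel_prob_measures_openin: "M \<in> borel_prob_measures T \<Longrightarrow> openin T V \<Longrightarrow> V \<in> sets M"
  by (auto simp: borel_prob_measures_def)

lemma borel_prob_measures_closedin:
  assumes "M \<in> borel_prob_measures T" "closedin T S"
  shows "S \<in> sets M"
proof -
  have "space M - (topspace T - S) \<in> sets M"
    using assms by (intro sets.compl_sets borel_prob_measures_openin) auto
  moreover have "space M - (topspace T - S) = S"
    using assms closedin_subset by (fastforce simp: borel_prob_measures_def)
  ultimately show ?thesis by simp
qed

lemma borel_prob_measures_continuous_map:
  fixes f :: "'b \<Rightarrow> 'a::topological_space"
  assumes "M \<in> borel_prob_measures T" "continuous_map T euclidean f"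
  shows "f \<in> borel_measurable M"
proof (rule borel_measurableI)
  fix W :: "'a set" assume "open W"
  then have "openin T {x \<in> topspace T. f x \<in> W}"
    using assms(2) by (auto simp: continuous_map_def)
  then show "f -` W \<inter> space M \<in> sets M"
    using borel_prob_measures_openin[OF assms(1)] assms(1)
    by (auto simp: borel_prob_measures_def vimage_def Int_def conj_commute)
qed

text \<open>
  A point outside the support has a null neighbourhood in the countable base, and there are only countably many of these.
\<close>

lemma msupport_complement_null:
  assumes M: "M \<in> borel_prob_measures T" and "second_countable T"
  shows "closedin T (msupport T M)" "topspace T - msupport T M \<in> null_sets M"
proof -
  obtain \<B> where \<B>: "countable \<B>" "\<forall>V\<in>\<B>. openin T V"
    "\<forall>W x. openin T W \<and> x \<in> W \<longrightarrow> (\<exists>V\<in>\<B>. x \<in> V \<and> V \<subseteq> W)"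
    using \<open>second_countable T\<close> unfolding second_countable_def by (elim exE conjE) (rule that)
  define \<N> where "\<N> = {V \<in> \<B>. emeasure M V = 0}"
  have eq: "topspace T - msupport T M = \<Union>\<N>"
  proof
    show "topspace T - msupport T M \<subseteq> \<Union>\<N>"
    proof
      fix x assume "x \<in> topspace T - msupport T M"
      then obtain W where W: "openin T W" "x \<in> W" "emeasure M W = 0"
        by (auto simp: msupport_def)
      then obtain V where V: "V \<in> \<B>" "x \<in> V" "V \<subseteq> W" using \<B>(3) by blast
      then have "emeasure M V = 0"
        using W borel_prob_measures_openin[OF M W(1)] emeasure_mono[of V W M] by simp
      then show "x \<in> \<Union>\<N>" using V by (auto simp: \<N>_def)
    qed
    show "\<Union>\<N> \<subseteq> topspace T - msupport T M"
      using \<B>(2) openin_subset by (fastforce simp: \<N>_def msupport_def)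
  qed
  have "openin T (\<Union>\<N>)" using \<B>(2) by (auto simp: \<N>_def)
  then have "closedin T (topspace T - \<Union>\<N>)" by blast
  moreover have "topspace T - \<Union>\<N> = msupport T M"
    using eq by (auto simp: msupport_def)
  ultimately show "closedin T (msupport T M)" by simp
  have "\<Union>\<N> \<in> null_sets M"
    using \<B>(1,2) borel_prob_measures_openin[OF M] null_sets_UN'[of \<N> id M] by (auto simp: \<N>_def)
  then show "topspace T - msupport T M \<in> null_sets M" by (simp add: eq)
qed

section \<open>The space of geodesics\<close>

lemma mspace_path_metric:
  "mspace (path_metric :: (real \<Rightarrow> 'a::metric_space) metric) = {c \<in> extensional {0..1}. continuous_on {0..1} c}"
  unfolding path_metric_def
  by (subst compactin_mspace_cfunspace) (auto simp: compactin_subtopology)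

lemma dist_le_path_dist:
  fixes c c' :: "real \<Rightarrow> 'a::metric_space"
  assumes "c \<in> mspace path_metric" "c' \<in> mspace path_metric" "s \<in> {0..1}"
  shows "dist (c s) (c' s) \<le> mdist path_metric c c'"
proof -
  have "mdist euclidean_metric (c s) (c' s) \<le> mdist path_metric c c'"
    using assms unfolding path_metric_def
    by (intro mdist_cfunspace_imp_mdist_le[OF _ _ order_refl]) (simp_all only: topspace_euclidean_subtopology)
  then show ?thesis by simp
qed

lemma path_dist_le:
  fixes c c' :: "real \<Rightarrow> 'a::metric_space"
  assumes "0 \<le> B" "\<And>s. s \<in> {0..1} \<Longrightarrow> dist (c s) (c' s) \<le> B"
  shows "mdist path_metric c c' \<le> B"
  using assms unfolding path_metric_def by (intro mdist_cfunspace_le) auto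

lemma mcomplete_path_metric: "mcomplete_of (path_metric :: (real \<Rightarrow> 'a::complete_space) metric)"
proof -
  have "Metric_space.mcomplete (UNIV :: 'a set) dist"
    using mcomplete_iff_complete complete_UNIV by simp
  from Met_TC.mcomplete_cfunspace[OF this, of "top_of_set {0..1}"]
  show ?thesis by (simp add: path_metric_def Met_TC.Self_def euclidean_metric_def)
qed

text \<open>
  The interpretations \<open>Path\<close> and \<open>Geo\<close> make the abstract metric-space facts available for curves; \<open>Geo.sub\<close> is the
  space of geodesics with the uniform distance.
\<close>

interpretation Path: Metric_space "mspace path_metric" "mdist path_metric"
  by (rule Metric_space_mspace_mdist)

interpretation Geo: Submetric "mspace path_metric" "mdist path_metric" "geodesics :: (real \<Rightarrow> 'a::metric_space) set"
  by unfold_locales (auto simp: geodesics_def)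

lemma geodesics_topology_eq: "geodesics_topology = Metric_space.mtopology geodesics (mdist path_metric)"
  by (simp add: geodesics_topology_def mtopology_of_def Geo.mtopology_submetric)

lemma topspace_geodesics [simp]: "topspace geodesics_topology = geodesics"
  by (simp add: geodesics_topology_eq)

lemma geodesicsD:
  assumes "c \<in> geodesics"
  shows "c \<in> mspace path_metric" "continuous_on {0..1} c"
    "s \<in> {0..1} \<Longrightarrow> r \<in> {0..1} \<Longrightarrow> dist (c s) (c r) = \<bar>s - r\<bar> * dist (c 0) (c 1)"
proof -
  have c: "c \<in> mspace path_metric" "geodesic_in UNIV dist c"
    using assms by (simp_all add: geodesics_def)
  show "c \<in> mspace path_metric" by fact
  then show "continuous_on {0..1} c" by (simp add: mspace_path_metric)
  assume "s \<in> {0..1}" "r \<in> {0..1}"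
  then show "dist (c s) (c r) = \<bar>s - r\<bar> * dist (c 0) (c 1)"
    using c(2) unfolding geodesic_in_def by (elim conjE) (drule(1) bspec, drule(1) bspec)
qed

lemma evl_continuous_map:
  assumes "s \<in> {0..1}"
  shows "continuous_map geodesics_topology euclidean (evl s :: _ \<Rightarrow> 'a::metric_space)"
proof -
  have "\<exists>\<delta>>0. \<forall>c'. c' \<in> geodesics \<and> mdist path_metric c c' < \<delta> \<longrightarrow> dist (evl s c) (evl s c') < e"
    if "c \<in> geodesics" "e > 0" for c :: "real \<Rightarrow> 'a" and e
  proof (intro exI[of _ e] conjI allI impI)
    fix c' assume "c' \<in> geodesics \<and> mdist path_metric c c' < e"
    then show "dist (evl s c) (evl s c') < e"
      using dist_le_path_dist[of c c' s] geodesicsD(1) that(1) assms by (fastforce simp: evl_def)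
  qed fact
  then have "continuous_map Geo.sub.mtopology Met_TC.mtopology (evl s :: _ \<Rightarrow> 'a)"
    unfolding Geo.sub.metric_continuous_map[OF Met_TC.Metric_space_axioms] by blast
  then show ?thesis
    by (simp add: geodesics_topology_eq)
qed

lemma limitin_geodesics_evl:
  assumes "limitin (mtopology_of path_metric) \<sigma> c sequentially" "\<And>n. \<sigma> n \<in> mspace path_metric" "s \<in> {0..1}"
  shows "(\<lambda>n. \<sigma> n s) \<longlonglongrightarrow> c s"
proof -
  have c: "c \<in> mspace path_metric" and lim: "(\<lambda>n. mdist path_metric (\<sigma> n) c) \<longlonglongrightarrow> 0"
    using assms(1) unfolding mtopology_of_def Path.limitin_metric_dist_null by blast+
  have "dist (\<sigma> n s) (c s) \<le> mdist path_metric (\<sigma> n) c" for n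
    using assms(2) c assms(3) by (rule dist_le_path_dist)
  then have "(\<lambda>n. dist (\<sigma> n s) (c s)) \<longlonglongrightarrow> 0"
    by (intro tendsto_sandwich[OF _ _ tendsto_const lim] always_eventually allI) simp_all
  then show ?thesis by (simp add: tendsto_dist_iff[symmetric])
qed

text \<open>
  The equation defining a geodesic involves finitely many values of the curve at a time, so it passes to uniform limits.
\<close>

lemma mcomplete_geodesics:
  "Metric_space.mcomplete (geodesics :: (real \<Rightarrow> 'a::complete_space) set) (mdist path_metric)"
proof -
  have "closedin (Metric_space.mtopology (mspace path_metric) (mdist path_metric)) (geodesics :: (real \<Rightarrow> 'a) set)"
    unfolding Path.metric_closedin_iff_sequentially_closed
  proof (intro conjI allI impI)
    fix \<sigma> and c :: "real \<Rightarrow> 'a"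
    assume *: "range \<sigma> \<subseteq> geodesics \<and> limitin (Metric_space.mtopology (mspace path_metric) (mdist path_metric)) \<sigma> c sequentially"
    then have \<sigma>: "\<sigma> n \<in> geodesics" for n by (simp add: image_subset_iff)
    have c: "c \<in> mspace path_metric" using * Path.limitin_mspace by blast
    have lim: "(\<lambda>n. \<sigma> n s) \<longlonglongrightarrow> c s" if "s \<in> {0..1}" for s
      using * \<sigma> geodesicsD(1) that by (intro limitin_geodesics_evl) (auto simp: mtopology_of_def)
    have "dist (c s) (c r) = \<bar>s - r\<bar> * dist (c 0) (c 1)" if "s \<in> {0..1}" "r \<in> {0..1}" for s r
    proof (rule LIMSEQ_unique)
      show "(\<lambda>n. dist (\<sigma> n s) (\<sigma> n r)) \<longlonglongrightarrow> dist (c s) (c r)"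
        using that by (intro tendsto_dist lim)
      show "(\<lambda>n. dist (\<sigma> n s) (\<sigma> n r)) \<longlonglongrightarrow> \<bar>s - r\<bar> * dist (c 0) (c 1)"
        unfolding geodesicsD(3)[OF \<sigma> that] by (intro tendsto_mult_left tendsto_dist lim) auto
    qed
    with c show "c \<in> geodesics" unfolding geodesics_def geodesic_in_def by blast
  qed (auto simp: geodesics_def)
  then show ?thesis
    using mcomplete_path_metric[where 'a='a] Geo.closedin_mcomplete_imp_mcomplete
    unfolding mcomplete_of_def by blast
qed

text \<open>
  A geodesic of length at most \<open>L\<close> is \<open>L\<close>-Lipschitz, so it is determined up to an error of order
  \<open>(L + 1)/N\<close> by its values at the times \<open>i/N\<close>, known up to \<open>1/N\<close>.  There are countably many such approximate data
  with points from a countable dense set; picking one geodesic for each datum that some geodesic matches gives a dense set.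
\<close>

lemma separable_geodesics:
  "separable_space (geodesics_topology :: (real \<Rightarrow> 'a::{metric_space, second_countable_topology}) topology)"
proof -
  obtain D :: "'a set" where D: "countable D" "\<forall>X. open X \<longrightarrow> X \<noteq> {} \<longrightarrow> (\<exists>d\<in>D. d \<in> X)"
    using countable_dense_exists by (elim exE conjE) (rule that)
  have D': "\<exists>p\<in>D. dist x p < r" if "r > 0" for x r
    using D(2)[rule_format, of "ball x r"] that by auto
  define P where "P = (\<lambda>(N::nat, L::nat, p) c. c \<in> geodesics \<and> dist (c 0) (c 1) \<le> real L \<and>
     (\<forall>i\<le>Suc N. dist (c (real i / Suc N) :: 'a) (p ! i) < 1 / Suc N))"
  define g where "g x = (SOME c. P x c)" for x
  define I where "I = {x \<in> UNIV \<times> UNIV \<times> lists D. \<exists>c. P x c}"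
  have gP: "P x (g x)" if "x \<in> I" for x
    using that someI_ex[of "P x"] unfolding I_def g_def by blast
  have "countable I"
    unfolding I_def using D(1) by (intro countable_subset[OF Collect_restrict]) auto
  moreover have "g ` I \<subseteq> geodesics"
    using gP by (auto simp: P_def split: prod.splits)
  moreover have "\<exists>c'\<in>g ` I. mdist path_metric c c' < r" if c: "c \<in> geodesics" and "r > 0" for c r
  proof -
    obtain L :: nat where L: "dist (c 0) (c 1) \<le> real L" by (meson real_arch_simple)
    obtain N :: nat where N: "1 / Suc N < r / (2 * L + 3)"
      using nat_approx_posE[of "r / (2 * L + 3)"] \<open>r > 0\<close> by (auto simp: field_simps)
    have "\<forall>i::nat. \<exists>p. p \<in> D \<and> dist (c (real i / Suc N)) p < 1 / Suc N"
      using D'[of "1 / Suc N"] by (simp add: Bex_def)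
    then obtain q where q: "\<And>i::nat. q i \<in> D" "\<And>i. dist (c (real i / Suc N)) (q i) < 1 / Suc N"
      by metis
    define x where "x = (N, L, map q [0..<Suc (Suc N)])"
    have "P x c"
      using c L q(2) by (auto simp: P_def x_def simp del: upt_Suc)
    then have x: "x \<in> I"
      using q(1) by (auto simp: I_def x_def)
    define c' where "c' = g x"
    have c': "c' \<in> geodesics" "dist (c' 0) (c' 1) \<le> L" "\<And>i. i \<le> Suc N \<Longrightarrow> dist (c' (real i / Suc N)) (q i) < 1 / Suc N"
      using gP[OF x] by (auto simp: P_def x_def c'_def nth_append simp del: upt_Suc)
    have "dist (c s) (c' s) \<le> (2 * real L + 2) / Suc N" if s: "s \<in> {0..1}" for s
    proof -
      \<comment> \<open>the grid point just before \<open>s\<close>\<close>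
      define i where "i = nat \<lfloor>s * Suc N\<rfloor>"
      have fl: "real i \<le> s * Suc N" "s * Suc N < real i + 1"
        using s by (auto simp: i_def)
      have "s * Suc N \<le> Suc N" using s by (simp add: mult_left_le_one_le)
      then have i: "i \<le> Suc N" using fl by linarith
      let ?s = "real i / Suc N"
      have s': "?s \<in> {0..1}" using i by auto
      have ds: "\<bar>s - ?s\<bar> \<le> 1 / Suc N"
      proof -
        have "s - ?s = (s * Suc N - i) / Suc N" by (simp add: diff_divide_distrib)
        moreover have "\<bar>s * Suc N - i\<bar> \<le> 1" using fl by linarith
        ultimately show ?thesis by (simp add: divide_right_mono del: of_nat_Suc)
      qed
      have 1: "dist (c s) (c ?s) \<le> 1 / Suc N * L"
        unfolding geodesicsD(3)[OF c s s'] using ds L by (intro mult_mono) auto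
      have 2: "dist (c' s) (c' ?s) \<le> 1 / Suc N * L"
        unfolding geodesicsD(3)[OF c'(1) s s'] using ds c'(2) by (intro mult_mono) auto
      have "dist (c s) (c' s) \<le> dist (c s) (c ?s) + dist (c ?s) (q i) + dist (c' ?s) (q i) + dist (c' s) (c' ?s)"
        by metric
      also have "\<dots> \<le> 1 / Suc N * L + 1 / Suc N + 1 / Suc N + 1 / Suc N * L"
        using 1 2 q(2)[of i] c'(3)[OF i] by linarith
      also have "\<dots> = (2 * real L + 2) / Suc N" by (simp add: add_divide_distrib del: of_nat_Suc)
      finally show ?thesis .
    qed
    then have "mdist path_metric c c' \<le> (2 * real L + 2) / Suc N"
      by (intro path_dist_le) auto
    also have "\<dots> \<le> (2 * real L + 3) * (1 / Suc N)" by (simp add: divide_right_mono del: of_nat_Suc)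
    also have "\<dots> < r"
      using N by (simp only: pos_less_divide_eq) (simp add: mult.commute)
    finally show ?thesis using x by (auto simp: c'_def)
  qed
  ultimately show ?thesis
    unfolding geodesics_topology_eq Geo.sub.separable_space_iff_dense by (meson countable_image)
qed

lemma geodesics_closed_subspace:
  fixes G :: "(real \<Rightarrow> 'a::polish_space) set"
  assumes "closedin geodesics_topology G"
  shows "Metric_space G (mdist path_metric)" "Metric_space.mcomplete G (mdist path_metric)"
    "Metric_space.mtopology G (mdist path_metric) = subtopology geodesics_topology G"
    "separable_space (Metric_space.mtopology G (mdist path_metric))"
proof -
  have G: "G \<subseteq> geodesics" using closedin_subset[OF assms] by simp
  interpret G: Submetric "geodesics :: (real \<Rightarrow> 'a) set" "mdist path_metric" G
    using G Geo.sub.Metric_space_axioms by (simp add: Submetric_def Submetric_axioms_def)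
  show "Metric_space G (mdist path_metric)" by (rule G.sub.Metric_space_axioms)
  show "G.sub.mcomplete"
    using assms mcomplete_geodesics by (intro G.closedin_mcomplete_imp_mcomplete) (auto simp: geodesics_topology_eq)
  show *: "G.sub.mtopology = subtopology geodesics_topology G"
    by (simp add: G.mtopology_submetric geodesics_topology_eq)
  have "second_countable (geodesics_topology :: (real \<Rightarrow> 'a) topology)"
    using separable_geodesics Geo.sub.separable_imp_second_countable by (simp add: geodesics_topology_eq)
  then show "separable_space G.sub.mtopology"
    unfolding * by (intro second_countable_imp_separable_space second_countable_subtopology)
qed

text \<open>
  Evaluation is continuous in time and measurable in the curve, so it is the pointwise limit of its versions with time
  rounded down to a grid, which are measurable because the grid is countable.
\<close>

lemma evaluation_measurable:
  fixes \<Gamma> :: "(real \<Rightarrow> 'a::metric_space) measure"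
  assumes \<Gamma>: "\<Gamma> \<in> borel_prob_measures geodesics_topology"
  shows "(\<lambda>(c, s). c s) \<in> borel_measurable (\<Gamma> \<Otimes>\<^sub>M restrict_space lborel {0..1})"
proof (rule borel_measurable_LIMSEQ_metric)
  let ?L = "restrict_space lborel {0..1::real}"
  have space_\<Gamma>: "space \<Gamma> = geodesics" using \<Gamma> by (simp add: borel_prob_measures_def)
  \<comment> \<open>rounding is clipped to \<open>[0,1]\<close> because evaluation is measurable only at those times\<close>
  define clip :: "nat \<Rightarrow> int \<Rightarrow> real" where "clip n i = max 0 (min 1 (real_of_int i / real (Suc n)))" for n i
  define f where "f n = (\<lambda>p :: (real \<Rightarrow> 'a) \<times> real. fst p (clip n \<lfloor>snd p * real (Suc n)\<rfloor>))" for n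
  show "f n \<in> borel_measurable (\<Gamma> \<Otimes>\<^sub>M ?L)" for n
    unfolding f_def
  proof (rule measurable_compose_countable[where f = "\<lambda>i p. fst p (clip n i)"])
    fix i
    have "evl (clip n i) \<in> borel_measurable \<Gamma>"
      by (intro borel_prob_measures_continuous_map[OF \<Gamma>] evl_continuous_map) (auto simp: clip_def)
    then have "(\<lambda>p. evl (clip n i) (fst p)) \<in> borel_measurable (\<Gamma> \<Otimes>\<^sub>M ?L)"
      by (rule measurable_compose[OF measurable_fst])
    then show "(\<lambda>p. fst p (clip n i)) \<in> borel_measurable (\<Gamma> \<Otimes>\<^sub>M ?L)"
      by (simp add: evl_def)
  next
    have [measurable]: "(\<lambda>s::real. s) \<in> borel_measurable ?L"
      by (intro measurable_restrict_space1) auto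
    show "(\<lambda>p. \<lfloor>snd p * real (Suc n)\<rfloor>) \<in> (\<Gamma> \<Otimes>\<^sub>M ?L) \<rightarrow>\<^sub>M count_space UNIV"
      by measurable
  qed
  fix p assume "p \<in> space (\<Gamma> \<Otimes>\<^sub>M ?L)"
  then obtain c s where p: "p = (c, s)" "c \<in> geodesics" "s \<in> {0..1}"
    by (auto simp: space_pair_measure space_\<Gamma> space_restrict_space)
  have clip: "clip n \<lfloor>s * real (Suc n)\<rfloor> \<in> {0..1}" for n by (auto simp: clip_def)
  have "dist (clip n \<lfloor>s * real (Suc n)\<rfloor>) s \<le> 1 / real (Suc n)" for n
  proof -
    have "s - real_of_int \<lfloor>s * real (Suc n)\<rfloor> / real (Suc n) = (s * Suc n - \<lfloor>s * real (Suc n)\<rfloor>) / Suc n"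
      by (simp add: diff_divide_distrib)
    moreover have "\<bar>s * Suc n - \<lfloor>s * real (Suc n)\<rfloor>\<bar> \<le> 1" by linarith
    ultimately have "\<bar>s - real_of_int \<lfloor>s * real (Suc n)\<rfloor> / real (Suc n)\<bar> \<le> 1 / Suc n"
      by (simp add: divide_right_mono del: of_nat_Suc)
    moreover have "dist (max 0 (min 1 x)) s \<le> \<bar>s - x\<bar>" for x
      using p(3) by (auto simp: dist_real_def max_def min_def)
    ultimately show ?thesis unfolding clip_def by (meson order_trans)
  qed
  then have "(\<lambda>n. dist (clip n \<lfloor>s * real (Suc n)\<rfloor>) s) \<longlonglongrightarrow> 0"
    by (intro tendsto_sandwich[OF _ _ tendsto_const LIMSEQ_Suc[OF lim_1_over_n]] always_eventually allI) simp_all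
  then have "(\<lambda>n. clip n \<lfloor>s * real (Suc n)\<rfloor>) \<longlonglongrightarrow> s" by (simp add: tendsto_dist_iff[symmetric])
  then have "(\<lambda>n. c (clip n \<lfloor>s * real (Suc n)\<rfloor>)) \<longlonglongrightarrow> c s"
    by (rule continuous_on_tendsto_compose[OF geodesicsD(2)[OF p(2)] _ p(3) always_eventually[OF allI[OF clip]]])
  then show "(\<lambda>n. f n p) \<longlonglongrightarrow> (case p of (c, s) \<Rightarrow> c s)"
    by (simp add: f_def p(1))
qed

section \<open>Tubes swept by compact sets of geodesics\<close>

text \<open>
  Tubes stand in for the metric neighbourhoods of \<open>e\<^sub>t(H)\<close>: for compact \<open>H\<close> they are compact, whereas a
  neighbourhood of a compact set may have infinite measure if the space is not locally compact.
\<close>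

definition tube :: "(real \<Rightarrow> 'a) set \<Rightarrow> real \<Rightarrow> real \<Rightarrow> 'a set" where
  "tube H t \<eta> = {c s | c s. c \<in> H \<and> s \<in> {0..1} \<and> \<bar>s - t\<bar> \<le> \<eta>}"

text \<open>
  Joint sequential compactness of \<open>(c, s) \<mapsto> c(s)\<close> on \<open>H \<times> [0,1]\<close>: along a subsequence the curves converge
  uniformly, and uniform convergence permits moving the time as well.
\<close>

lemma compactin_geodesics_evaluation:
  fixes H :: "(real \<Rightarrow> 'a::metric_space) set"
  assumes H: "compactin geodesics_topology H" and \<sigma>: "\<And>n. \<sigma> n \<in> H"
    and s: "\<And>n. s n \<in> {0..1}" "s \<longlonglongrightarrow> t"
  obtains r c where "strict_mono r" "c \<in> H" "(\<lambda>n. \<sigma> (r n) (s (r n))) \<longlonglongrightarrow> c t"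
proof -
  obtain r c where r: "strict_mono r" "c \<in> H" "limitin geodesics_topology (\<sigma> \<circ> r) c sequentially"
  proof -
    have "range \<sigma> \<subseteq> H" using \<sigma> by (simp add: image_subset_iff)
    with H show ?thesis
      unfolding geodesics_topology_eq Geo.sub.compactin_sequentially
      by (elim conjE) (drule spec, drule(1) mp, elim exE conjE, rule that[unfolded geodesics_topology_eq])
  qed
  have HG: "H \<subseteq> geodesics" using compactin_subset_topspace[OF H] by simp
  have lim: "(\<lambda>n. mdist path_metric ((\<sigma> \<circ> r) n) c) \<longlonglongrightarrow> 0"
    using r(3) unfolding geodesics_topology_eq Geo.sub.limitin_metric_dist_null by (elim conjE)
  have c: "c \<in> geodesics" using HG r(2) by blast
  have t: "t \<in> {0..1}" by (rule closed_sequentially[OF closed_atLeastAtMost s])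
  have sr: "(\<lambda>n. s (r n)) \<longlonglongrightarrow> t" using LIMSEQ_subseq_LIMSEQ[OF s(2) r(1)] by (simp add: o_def)
  then have "(\<lambda>n. c (s (r n))) \<longlonglongrightarrow> c t"
    using s(1) by (intro continuous_on_tendsto_compose[OF geodesicsD(2)[OF c] _ t]) auto
  then have "(\<lambda>n. dist (c (s (r n))) (c t)) \<longlonglongrightarrow> 0" by (simp add: tendsto_dist_iff[symmetric])
  from tendsto_add[OF lim this]
  have lim': "(\<lambda>n. mdist path_metric ((\<sigma> \<circ> r) n) c + dist (c (s (r n))) (c t)) \<longlonglongrightarrow> 0" by simp
  have "dist (\<sigma> (r n) (s (r n))) (c t) \<le> mdist path_metric ((\<sigma> \<circ> r) n) c + dist (c (s (r n))) (c t)" for n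
  proof -
    have "dist (\<sigma> (r n) (s (r n))) (c (s (r n))) \<le> mdist path_metric (\<sigma> (r n)) c"
      using HG \<sigma> c s(1) by (intro dist_le_path_dist geodesicsD(1)) auto
    then show ?thesis
      using dist_triangle[of "\<sigma> (r n) (s (r n))" "c t" "c (s (r n))"] by simp
  qed
  then have "(\<lambda>n. dist (\<sigma> (r n) (s (r n))) (c t)) \<longlonglongrightarrow> 0"
    by (intro tendsto_sandwich[OF _ _ tendsto_const lim'] always_eventually allI) simp_all
  then have "(\<lambda>n. \<sigma> (r n) (s (r n))) \<longlonglongrightarrow> c t" by (simp add: tendsto_dist_iff[symmetric])
  then show ?thesis by (rule that[OF r(1,2)])
qed

lemma compact_tube:
  fixes H :: "(real \<Rightarrow> 'a::metric_space) set"
  assumes H: "compactin geodesics_topology H"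
  shows "compact (tube H t \<eta>)"
  unfolding compact_def
proof (intro allI impI)
  fix x :: "nat \<Rightarrow> 'a" assume "\<forall>n. x n \<in> tube H t \<eta>"
  then have "\<forall>n. \<exists>c s. x n = c s \<and> c \<in> H \<and> s \<in> {0..1} \<inter> {t - \<eta>..t + \<eta>}"
    unfolding tube_def by (fastforce simp: abs_le_iff)
  then obtain \<sigma> s where *: "\<And>n. x n = \<sigma> n (s n)" "\<And>n. \<sigma> n \<in> H" "\<And>n. s n \<in> {0..1} \<inter> {t - \<eta>..t + \<eta>}"
    by metis
  have "compact ({0..1} \<inter> {t - \<eta>..t + \<eta>})" by (intro compact_Int compact_Icc)
  moreover have "\<forall>n. s n \<in> {0..1} \<inter> {t - \<eta>..t + \<eta>}" using *(3) by blast
  ultimately obtain s' r where r: "s' \<in> {0..1} \<inter> {t - \<eta>..t + \<eta>}" "strict_mono r" "(s \<circ> r) \<longlonglongrightarrow> s'"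
    by (rule seq_compactE[OF compact_imp_seq_compact])
  have "(\<sigma> \<circ> r) n \<in> H" "(s \<circ> r) n \<in> {0..1}" for n using *(2,3) by simp_all
  then obtain r' c where r': "strict_mono r'" "c \<in> H" "(\<lambda>n. (\<sigma> \<circ> r) (r' n) ((s \<circ> r) (r' n))) \<longlonglongrightarrow> c s'"
    by (rule compactin_geodesics_evaluation[OF H _ _ r(3)])
  have "c s' \<in> tube H t \<eta>" using r(1) r'(2) unfolding tube_def
    by (auto simp: abs_le_iff intro!: exI[of _ c] exI[of _ s'])
  moreover have "strict_mono (r \<circ> r')" using r(2) r'(1) by (rule strict_mono_o)
  moreover have "(x \<circ> (r \<circ> r')) \<longlonglongrightarrow> c s'" using r'(3) by (simp add: o_def *(1))
  ultimately show "\<exists>l\<in>tube H t \<eta>. \<exists>r. strict_mono r \<and> (x \<circ> r) \<longlonglongrightarrow> l"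
    by (intro bexI[of _ "c s'"] exI[of _ "r \<circ> r'"] conjI)
qed

lemma INT_tube:
  fixes H :: "(real \<Rightarrow> 'a::metric_space) set"
  assumes H: "compactin geodesics_topology H" and t: "t \<in> {0..1}"
  shows "(\<Inter>n. tube H t (1 / real (Suc n))) = evl t ` H"
proof
  show "evl t ` H \<subseteq> (\<Inter>n. tube H t (1 / real (Suc n)))"
    using t by (auto simp: tube_def evl_def intro!: exI[of _ t])
  show "(\<Inter>n. tube H t (1 / real (Suc n))) \<subseteq> evl t ` H"
  proof
    fix x assume x: "x \<in> (\<Inter>n. tube H t (1 / real (Suc n)))"
    have "\<forall>n. \<exists>c s. x = c s \<and> c \<in> H \<and> s \<in> {0..1} \<and> \<bar>s - t\<bar> \<le> 1 / real (Suc n)"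
      using x unfolding tube_def by blast
    then obtain \<sigma> s where *: "\<And>n. x = \<sigma> n (s n)" "\<And>n. \<sigma> n \<in> H" "\<And>n. s n \<in> {0..1}" "\<And>n. \<bar>s n - t\<bar> \<le> 1 / real (Suc n)"
      by metis
    have "(\<lambda>n. dist (s n) t) \<longlonglongrightarrow> 0"
      using *(4) by (intro tendsto_sandwich[OF _ _ tendsto_const LIMSEQ_Suc[OF lim_1_over_n]] always_eventually allI)
        (simp_all add: dist_real_def)
    then have "s \<longlonglongrightarrow> t" by (simp add: tendsto_dist_iff[symmetric])
    then obtain r c where r: "strict_mono r" "c \<in> H" "(\<lambda>n. \<sigma> (r n) (s (r n))) \<longlonglongrightarrow> c t"
      by (rule compactin_geodesics_evaluation[OF H *(2) *(3)])
    have "(\<lambda>n. x) \<longlonglongrightarrow> c t" using r(3) *(1) by simp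
    then have "x = c t" by (simp add: LIMSEQ_const_iff)
    then show "x \<in> evl t ` H" using r(2) by (auto simp: evl_def)
  qed
qed

section \<open>Mass of the image of the plan at nearby times\<close>

text \<open>
  Here the density bound enters.  The set \<open>K\<close> carries almost all mass at time \<open>t\<close>; at nearby times the mass may have
  moved off \<open>K\<close>, but only within a thin tube around it.  Since \<open>m(T\<^sub>\<eta> - K)\<close> is small, a measure dominated by \<open>C m\<close>
  has almost all its mass on \<open>K\<close> as well.  Finiteness of \<open>m\<close> on compact sets is what makes \<open>m(T\<^sub>\<eta> - K)\<close> tend to \<open>0\<close>.
\<close>

lemma evaluation_image_mass_continuity:
  fixes m :: "'a::polish_space measure" and \<Gamma> :: "(real \<Rightarrow> 'a) measure"
  assumes m: "sets m = sets borel" "\<And>K. compact K \<Longrightarrow> emeasure m K < \<infinity>"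
    and \<Gamma>: "\<Gamma> \<in> borel_prob_measures geodesics_topology"
    and G: "closedin geodesics_topology G" "emeasure \<Gamma> G = 1"
    and t: "t \<in> {0..1}" and "\<eta> > 0"
    and bound: "\<And>s B. s \<in> {0..1} \<Longrightarrow> \<bar>s - t\<bar> < \<eta> \<Longrightarrow> B \<in> sets borel \<Longrightarrow>
       emeasure (distr \<Gamma> borel (evl s)) B \<le> ennreal C * emeasure m B"
    and a: "0 \<le> a" "a < 1"
  obtains K \<delta> where "compact K" "K \<subseteq> evl t ` G" "\<delta> > 0"
    "\<And>s. s \<in> {0..1} \<Longrightarrow> \<bar>s - t\<bar> < \<delta> \<Longrightarrow> a \<le> measure (distr \<Gamma> borel (evl s)) K"
proof -
  interpret \<Gamma>: prob_space \<Gamma> using \<Gamma> by (simp add: borel_prob_measures_def)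
  have space_\<Gamma>: "space \<Gamma> = geodesics" using \<Gamma> by (simp add: borel_prob_measures_def)
  interpret G: Metric_space G "mdist path_metric" by (rule geodesics_closed_subspace(1)[OF G(1)])
  have evl [measurable]: "evl s \<in> borel_measurable \<Gamma>" if "s \<in> {0..1}" for s
    by (intro borel_prob_measures_continuous_map[OF \<Gamma>] evl_continuous_map that)
  have G_sets: "G \<in> sets \<Gamma>" by (rule borel_prob_measures_closedin[OF \<Gamma> G(1)])
  have G_sub: "G \<subseteq> space \<Gamma>" using sets.sets_into_space[OF G_sets] .
  \<comment> \<open>half of the gap \<open>1 - a\<close> is lost by passing to compact \<open>H\<close>, the other half by passing from tube to \<open>K\<close>\<close>
  define b where "b = (a + 1) / 2"
  have b: "a < b" "b < 1" "0 \<le> b" using a by (auto simp: b_def)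
  obtain H where H: "compactin G.mtopology H"
    "\<And>V. openin G.mtopology V \<Longrightarrow> H \<subseteq> V \<Longrightarrow> ennreal b < outer_measure_of \<Gamma> V"
  proof (rule G.capacity_compact[where \<phi> = "outer_measure_of \<Gamma>"])
    show "G.mcomplete" "separable_space G.mtopology"
      using geodesics_closed_subspace[OF G(1)] by simp_all
    show "outer_measure_of \<Gamma> A \<le> outer_measure_of \<Gamma> B" if "A \<subseteq> B" for A B
      using that by (rule outer_measure_of_mono)
    show "outer_measure_of \<Gamma> (\<Union>n. A n) = (SUP n. outer_measure_of \<Gamma> (A n))"
      if "incseq A" "\<And>n. A n \<subseteq> G" for A :: "nat \<Rightarrow> _"
      using that G_sub by (intro SUP_outer_measure_of_incseq[symmetric]) blast+
    show "ennreal b < outer_measure_of \<Gamma> G" using G_sets G(2) b by (simp add: ennreal_less_one_iff)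
  qed (rule that)
  have HG: "H \<subseteq> G" using compactin_subset_topspace[OF H(1)] by simp
  have HT: "compactin geodesics_topology H"
    using H(1) unfolding geodesics_closed_subspace(3)[OF G(1)] compactin_subtopology by blast
  define K where "K = evl t ` H"
  have compK: "compact K"
    using image_compactin[OF HT evl_continuous_map[OF t]] by (simp add: K_def)
  let ?T = "\<lambda>n. tube H t (1 / real (Suc n))"
  have INT_T: "(\<Inter>n. ?T n) = K" unfolding K_def by (rule INT_tube[OF HT t])
  have T_borel: "?T n \<in> sets borel" for n by (intro borel_compact compact_tube HT)
  have KT: "K \<subseteq> ?T n" for n using INT_T by blast
  \<comment> \<open>capacitability controls only neighbourhoods of \<open>H\<close>: preimages of open sets around the tube are such, and
    outer regularity then reaches the tube itself\<close>
  have tube_mass: "b \<le> measure (distr \<Gamma> borel (evl s)) (?T n)"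
    if s: "s \<in> {0..1}" "\<bar>s - t\<bar> \<le> 1 / real (Suc n)" for s n
  proof -
    let ?N = "distr \<Gamma> borel (evl s)"
    interpret N: prob_space ?N using evl[OF s(1)] by (rule \<Gamma>.prob_space_distr)
    have "ennreal b \<le> emeasure ?N W" if W: "?T n \<subseteq> W" "open W" for W
    proof -
      have "openin geodesics_topology {c \<in> topspace geodesics_topology. evl s c \<in> W}"
        using evl_continuous_map[OF s(1)] W(2) by (auto simp: continuous_map_def)
      then have "openin G.mtopology (G \<inter> {c \<in> topspace geodesics_topology. evl s c \<in> W})"
        unfolding geodesics_closed_subspace(3)[OF G(1)] by (rule openin_subtopology_Int2)
      moreover have "H \<subseteq> G \<inter> {c \<in> topspace geodesics_topology. evl s c \<in> W}"
      proof
        fix c assume c: "c \<in> H"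
        then have "c s \<in> ?T n" using s unfolding tube_def by blast
        then show "c \<in> G \<inter> {c \<in> topspace geodesics_topology. evl s c \<in> W}"
          using c HG G_sub W(1) by (auto simp: evl_def space_\<Gamma>)
      qed
      ultimately have "ennreal b < outer_measure_of \<Gamma> (G \<inter> {c \<in> topspace geodesics_topology. evl s c \<in> W})"
        by (rule H(2))
      also have "\<dots> \<le> outer_measure_of \<Gamma> (evl s -` W \<inter> space \<Gamma>)"
        by (intro outer_measure_of_mono) (auto simp: space_\<Gamma>)
      also have "\<dots> = emeasure ?N W"
        using evl[OF s(1)] W(2) by (simp add: emeasure_distr measurable_sets_borel)
      finally show ?thesis by simp
    qed
    then have "ennreal b \<le> (INF W\<in>{W. ?T n \<subseteq> W \<and> open W}. emeasure ?N W)"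
      by (intro INF_greatest) auto
    also have "\<dots> = emeasure ?N (?T n)"
      by (intro outer_regular[symmetric] T_borel) auto
    finally show ?thesis by (simp add: N.emeasure_eq_measure)
  qed
  have "(\<lambda>n. emeasure m (?T n - K)) \<longlonglongrightarrow> emeasure m (\<Inter>n. ?T n - K)"
  proof (rule Lim_emeasure_decseq)
    show "range (\<lambda>n. ?T n - K) \<subseteq> sets m"
      using T_borel borel_compact[OF compK] m(1) by auto
    have "?T (Suc n) \<subseteq> ?T n" for n
    proof
      fix x assume "x \<in> ?T (Suc n)"
      then obtain c s where c: "x = c s" "c \<in> H" "s \<in> {0..1}" "\<bar>s - t\<bar> \<le> 1 / real (Suc (Suc n))"
        unfolding tube_def by blast
      moreover have "1 / real (Suc (Suc n)) \<le> 1 / real (Suc n)" by (simp add: frac_le)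
      ultimately have "\<bar>s - t\<bar> \<le> 1 / real (Suc n)" by linarith
      with c show "x \<in> ?T n" unfolding tube_def by blast
    qed
    then show "decseq (\<lambda>n. ?T n - K)" by (intro decseq_SucI Diff_mono) auto
    fix n
    have "emeasure m (?T n - K) \<le> emeasure m (?T n)"
      using T_borel m(1) by (intro emeasure_mono) auto
    also have "\<dots> < \<infinity>" by (intro m(2) compact_tube HT)
    finally show "emeasure m (?T n - K) \<noteq> \<infinity>" by simp
  qed
  moreover have "(\<Inter>n. ?T n - K) = {}" using INT_T by blast
  ultimately have "(\<lambda>n. emeasure m (?T n - K)) \<longlonglongrightarrow> 0"
    by (simp only: emeasure_empty)
  then have "(\<lambda>n. ennreal C * emeasure m (?T n - K)) \<longlonglongrightarrow> ennreal C * 0"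
    by (intro ennreal_tendsto_cmult) auto
  then have "eventually (\<lambda>n. ennreal C * emeasure m (?T n - K) < ennreal (b - a)) sequentially"
    using b by (intro order_tendstoD(2)[of _ "ennreal C * 0"]) auto
  then obtain n where n: "ennreal C * emeasure m (?T n - K) < ennreal (b - a)"
    by (auto simp: eventually_sequentially)
  show ?thesis
  proof (rule that[OF compK])
    show "K \<subseteq> evl t ` G" unfolding K_def using HG by (rule image_mono)
    show "min \<eta> (1 / real (Suc n)) > 0" using \<open>\<eta> > 0\<close> by simp
    fix s assume s: "s \<in> {0..1}" "\<bar>s - t\<bar> < min \<eta> (1 / real (Suc n))"
    let ?N = "distr \<Gamma> borel (evl s)"
    interpret N: prob_space ?N using evl[OF s(1)] by (rule \<Gamma>.prob_space_distr)
    have "emeasure ?N (?T n - K) \<le> ennreal C * emeasure m (?T n - K)"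
      using s T_borel borel_compact[OF compK] by (intro bound) auto
    also note n
    finally have "measure ?N (?T n - K) < b - a"
      using b by (simp add: N.emeasure_eq_measure ennreal_less_iff)
    moreover have "measure ?N (?T n - K) = measure ?N (?T n) - measure ?N K"
      using T_borel borel_compact[OF compK] KT by (intro N.finite_measure_Diff) auto
    moreover have "b \<le> measure ?N (?T n)" using s by (intro tube_mass) auto
    ultimately show "a \<le> measure ?N K" by linarith
  qed
qed

section \<open>Time spent in a set\<close>

lemma measurable_completion_AE:
  fixes f g :: "'a \<Rightarrow> 'b::topological_space"
  assumes g: "g \<in> borel_measurable M" and AE: "AE x in M. f x = g x"
  shows "f \<in> borel_measurable (completion M)"
proof (rule measurableI)
  fix S :: "'b set" assume S: "S \<in> sets borel"
  show "f -` S \<inter> space (completion M) \<in> sets (completion M)"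
  proof (rule completion.in_sets_AE)
    show "g -` S \<inter> space M \<in> sets (completion M)" using measurable_sets[OF g S] by simp
    have "AE x in M. x \<in> g -` S \<inter> space M \<longleftrightarrow> x \<in> f -` S \<inter> space (completion M)"
      using AE by eventually_elim auto
    then show "AE x in completion M. x \<in> g -` S \<inter> space M \<longleftrightarrow> x \<in> f -` S \<inter> space (completion M)"
      by (rule AE_completion)
  qed auto
qed auto

abbreviation unit_lborel :: "real measure" where
  "unit_lborel \<equiv> restrict_space lborel {0..1}"

lemma prob_space_unit_lborel: "prob_space unit_lborel"
  by (rule prob_space_restrict_space) simp_all

definition visit_times :: "'a set \<Rightarrow> (real \<Rightarrow> 'a) \<Rightarrow> real set" where
  "visit_times B c = {s \<in> {0..1}. c s \<in> B}"

lemma hit_times_eq_visit_times: "hit_times t G c = visit_times (evl t ` G) c"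
  by (simp add: hit_times_def visit_times_def)

context
  fixes \<Gamma> :: "(real \<Rightarrow> 'a::metric_space) measure"
  assumes \<Gamma>: "\<Gamma> \<in> borel_prob_measures geodesics_topology"
begin

lemma pair_prob_plan: "pair_prob_space \<Gamma> unit_lborel"
  using \<Gamma> prob_space_unit_lborel
  by (simp add: pair_prob_space_def pair_sigma_finite_def borel_prob_measures_def prob_space_imp_sigma_finite)

lemma visit_pairs_measurable:
  assumes "B \<in> sets borel" "J \<in> sets borel"
  shows "{p \<in> space (\<Gamma> \<Otimes>\<^sub>M unit_lborel). fst p (snd p) \<in> B \<and> snd p \<in> J} \<in> sets (\<Gamma> \<Otimes>\<^sub>M unit_lborel)"
proof -
  have [measurable]: "(\<lambda>p. fst p (snd p)) \<in> borel_measurable (\<Gamma> \<Otimes>\<^sub>M unit_lborel)"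
    using evaluation_measurable[OF \<Gamma>] by (simp add: case_prod_beta)
  have [measurable]: "snd \<in> borel_measurable (\<Gamma> \<Otimes>\<^sub>M unit_lborel)"
    by (intro measurable_compose[OF measurable_snd] measurable_restrict_space1) auto
  note [measurable] = assms
  show ?thesis by measurable
qed

lemma visit_pairs_section:
  assumes "c \<in> space \<Gamma>"
  shows "Pair c -` {p \<in> space (\<Gamma> \<Otimes>\<^sub>M unit_lborel). fst p (snd p) \<in> B \<and> snd p \<in> J} = visit_times B c \<inter> J"
  using assms by (auto simp: visit_times_def space_pair_measure space_restrict_space)

lemma visit_times_sets:
  assumes "c \<in> space \<Gamma>" "B \<in> sets borel"
  shows "visit_times B c \<in> sets borel"
proof -
  have "visit_times B c \<inter> UNIV \<in> sets unit_lborel"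
    unfolding visit_pairs_section[OF assms(1), symmetric]
    by (rule sets_Pair1[OF visit_pairs_measurable[OF assms(2)]]) simp
  then show ?thesis by (simp add: sets_restrict_space_iff)
qed

text \<open>
  A section of a measurable subset of the product of curves and times: the form to which Tonelli's theorem applies.
\<close>

lemma emeasure_visit_times:
  assumes "c \<in> space \<Gamma>"
  shows "emeasure lborel (visit_times B c \<inter> J) =
     emeasure unit_lborel (Pair c -` {p \<in> space (\<Gamma> \<Otimes>\<^sub>M unit_lborel). fst p (snd p) \<in> B \<and> snd p \<in> J})"
  unfolding visit_pairs_section[OF assms]
  by (subst emeasure_restrict_space) (auto simp: visit_times_def)

lemma emeasure_visit_times_measurable:
  assumes "B \<in> sets borel" "J \<in> sets borel"
  shows "(\<lambda>c. emeasure lborel (visit_times B c \<inter> J)) \<in> borel_measurable \<Gamma>"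
proof -
  interpret pair_prob_space \<Gamma> unit_lborel by (rule pair_prob_plan)
  show ?thesis
    using M2.measurable_emeasure_Pair[OF visit_pairs_measurable[OF assms]]
    by (simp add: emeasure_visit_times cong: measurable_cong)
qed

text \<open>
  By Tonelli the right-hand side is the integral over \<open>s \<in> J\<close> of the mass that the marginal at time \<open>s\<close> gives to \<open>B\<close>.
\<close>

lemma nn_integral_visit_times:
  assumes "B \<in> sets borel" "J \<in> sets borel" "J \<subseteq> {0..1}"
    and a: "\<And>s. s \<in> J \<Longrightarrow> ennreal a \<le> emeasure (distr \<Gamma> borel (evl s)) B"
  shows "ennreal a * emeasure lborel J \<le> (\<integral>\<^sup>+ c. emeasure lborel (visit_times B c \<inter> J) \<partial>\<Gamma>)"
proof -
  interpret pair_prob_space \<Gamma> unit_lborel by (rule pair_prob_plan)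
  let ?Q = "{p \<in> space (\<Gamma> \<Otimes>\<^sub>M unit_lborel). fst p (snd p) \<in> B \<and> snd p \<in> J}"
  note Q = visit_pairs_measurable[OF assms(1,2)]
  have "ennreal a * emeasure lborel J = (\<integral>\<^sup>+ s. ennreal a * indicator J s \<partial>unit_lborel)"
    using assms by (simp add: nn_integral_cmult_indicator sets_restrict_space_iff emeasure_restrict_space)
  also have "\<dots> \<le> (\<integral>\<^sup>+ s. emeasure \<Gamma> ((\<lambda>c. (c, s)) -` ?Q) \<partial>unit_lborel)"
  proof (rule nn_integral_mono)
    fix s assume "s \<in> space unit_lborel"
    then have s: "s \<in> {0..1}" by (simp add: space_restrict_space)
    show "ennreal a * indicator J s \<le> emeasure \<Gamma> ((\<lambda>c. (c, s)) -` ?Q)"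
    proof (cases "s \<in> J")
      case True
      have "(\<lambda>c. (c, s)) -` ?Q = evl s -` B \<inter> space \<Gamma>"
        using s True by (auto simp: space_pair_measure space_restrict_space evl_def)
      moreover have "evl s \<in> borel_measurable \<Gamma>"
        by (intro borel_prob_measures_continuous_map[OF \<Gamma>] evl_continuous_map s)
      ultimately show ?thesis using a[OF True] True assms(1) by (simp add: emeasure_distr)
    qed simp
  qed
  also have "\<dots> = emeasure (\<Gamma> \<Otimes>\<^sub>M unit_lborel) ?Q"
    by (rule emeasure_pair_measure_alt2[OF Q, symmetric])
  also have "\<dots> = (\<integral>\<^sup>+ c. emeasure unit_lborel (Pair c -` ?Q) \<partial>\<Gamma>)"
    by (rule M2.emeasure_pair_measure_alt[OF Q])
  also have "\<dots> = (\<integral>\<^sup>+ c. emeasure lborel (visit_times B c \<inter> J) \<partial>\<Gamma>)"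
    by (intro nn_integral_cong emeasure_visit_times[symmetric])
  finally show ?thesis .
qed

text \<open>
  The null set is for the occupation measure, the law of \<open>c(s)\<close> for a random curve and a uniform time, so by Fubini almost
  every curve is in \<open>B' - B\<close> for a null set of times only.  Completeness of Lebesgue measure does the rest, for all \<open>J\<close>
  with one exceptional set of curves.
\<close>

lemma visit_times_sandwich:
  assumes B: "B \<in> sets borel" "B' \<in> sets borel" "B \<subseteq> A" "A \<subseteq> B'"
    and null: "B' - B \<in> null_sets (distr (\<Gamma> \<Otimes>\<^sub>M unit_lborel) borel (\<lambda>(c, s). c s))"
  shows "AE c in \<Gamma>. visit_times A c \<in> sets lebesgue \<and>
    (\<forall>J \<in> sets borel. measure lebesgue (visit_times A c \<inter> J) = measure lborel (visit_times B c \<inter> J))"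
proof -
  interpret pair_prob_space \<Gamma> unit_lborel by (rule pair_prob_plan)
  have "AE x in distr (\<Gamma> \<Otimes>\<^sub>M unit_lborel) borel (\<lambda>(c, s). c s). x \<notin> B' - B"
    using null by (rule AE_not_in)
  then have "AE p in \<Gamma> \<Otimes>\<^sub>M unit_lborel. (case p of (c, s) \<Rightarrow> c s) \<notin> B' - B"
    by (rule AE_distrD[OF evaluation_measurable[OF \<Gamma>]])
  then have p: "AE p in \<Gamma> \<Otimes>\<^sub>M unit_lborel. fst p (snd p) \<notin> B' - B"
    by (simp only: case_prod_beta)
  have AE2: "AE c in \<Gamma>. AE s in unit_lborel. c s \<notin> B' - B"
    using AE_pair[where Q = "\<lambda>p. fst p (snd p) \<notin> B' - B", OF p] by (simp only: fst_conv snd_conv)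
  have concl: "visit_times A c \<in> sets lebesgue \<and>
      (\<forall>J \<in> sets borel. measure lebesgue (visit_times A c \<inter> J) = measure lborel (visit_times B c \<inter> J))"
    if c: "c \<in> space \<Gamma>" "AE s in unit_lborel. c s \<notin> B' - B" for c
  proof -
    define N where "N = visit_times (B' - B) c"
    have "N \<in> sets lborel"
      unfolding N_def using visit_times_sets[OF c(1)] B(1,2) by simp
    moreover have "AE s in lborel. s \<in> {0..1} \<longrightarrow> c s \<notin> B' - B"
      using c(2) by (subst (asm) AE_restrict_space_iff) simp_all
    then have "AE s in lborel. s \<notin> N"
      by eventually_elim (auto simp: N_def visit_times_def)
    ultimately have N: "N \<in> null_sets lborel" by (simp add: AE_iff_null_sets)
    have vB: "visit_times B c \<in> sets lborel" using visit_times_sets[OF c(1)] B(1) by simp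
    have sub: "visit_times A c - visit_times B c \<subseteq> N" "visit_times B c \<subseteq> visit_times A c"
      using B(3,4) by (auto simp: N_def visit_times_def)
    have vA: "visit_times A c \<in> sets lebesgue"
      by (rule sets_completionI[OF _ sub(1) N vB]) (use sub(2) in blast)
    moreover have "measure lebesgue (visit_times A c \<inter> J) = measure lborel (visit_times B c \<inter> J)"
      if J: "J \<in> sets borel" for J
    proof -
      have "AE s in lebesgue. s \<notin> N" using AE_not_in[OF N] by (rule AE_completion)
      then have "AE s in lebesgue. s \<in> visit_times A c \<inter> J \<longleftrightarrow> s \<in> visit_times B c \<inter> J"
        by eventually_elim (use sub in blast)
      then have "emeasure lebesgue (visit_times A c \<inter> J) = emeasure lebesgue (visit_times B c \<inter> J)"
        using vA vB J by (intro emeasure_eq_AE) auto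
      then show ?thesis using vB J by (simp add: measure_def)
    qed
    ultimately show ?thesis by blast
  qed
  show ?thesis
    by (rule AE_mp[OF AE2 AE_I2]) (intro impI concl)
qed

end

section \<open>Density of the hitting times\<close>

theorem theorem2p1:
  fixes m :: "'a::polish_space measure"
    and \<mu> :: "real \<Rightarrow> 'a measure"
    and \<Gamma> :: "(real \<Rightarrow> 'a) measure"
    and G :: "(real \<Rightarrow> 'a) set"
    and \<rho> :: "real \<Rightarrow> 'a \<Rightarrow> ennreal"
    and t C :: real
    and U :: "real set"
  assumes m_borel: "sets m = sets borel"
    and m_compact_finite: "\<And>K. compact K \<Longrightarrow> emeasure m K < \<infinity>"
    and m_support: "msupport euclidean m = UNIV"
    and X_geodesic: "geodesic_space (UNIV :: 'a set) dist"
    and mu_geodesic: "geodesic_in P2 W2 \<mu>"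
    and plan: "dynamical_optimal_plan \<mu> \<Gamma>"
    and G_def: "G = msupport geodesics_topology \<Gamma>"
    and t: "0 < t" "t < 1"
    and C_pos: "C > 0"
    and U_nbhd: "U \<subseteq> {0..1}" "t \<in> interior U"
    and rho_measurable: "\<And>\<tau>. \<tau> \<in> U \<Longrightarrow> \<rho> \<tau> \<in> borel_measurable m"
    and rho_density: "\<And>\<tau>. \<tau> \<in> U \<Longrightarrow> \<mu> \<tau> = density m (\<rho> \<tau>)"
    and rho_bound: "\<And>\<tau>. \<tau> \<in> U \<Longrightarrow> AE x in m. \<rho> \<tau> x \<le> ennreal C"
  shows "(\<forall>\<epsilon>>0. set_integrable (completion \<Gamma>) G
            (\<lambda>\<gamma>. measure lebesgue (hit_times t G \<gamma> \<inter> {t - \<epsilon><..<t + \<epsilon>}) / (2 * \<epsilon>))) \<and>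
         ((\<lambda>\<epsilon>. LINT \<gamma>:G|completion \<Gamma>.
              \<bar>measure lebesgue (hit_times t G \<gamma> \<inter> {t - \<epsilon><..<t + \<epsilon>}) / (2 * \<epsilon>) - 1\<bar>)
            \<longlongrightarrow> 0) (at_right 0)"
proof -
  have \<Gamma>: "\<Gamma> \<in> borel_prob_measures geodesics_topology"
    and marg: "\<And>\<tau>. \<tau> \<in> {0..1} \<Longrightarrow> distr \<Gamma> borel (evl \<tau>) = \<mu> \<tau>"
    using plan by (auto simp: dynamical_optimal_plan_def)
  interpret \<Gamma>: prob_space \<Gamma> using \<Gamma> by (simp add: borel_prob_measures_def)
  interpret C\<Gamma>: prob_space "completion \<Gamma>" by (rule \<Gamma>.prob_space_completion)
  interpret P: pair_prob_space \<Gamma> unit_lborel by (rule pair_prob_plan[OF \<Gamma>])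
  have space_\<Gamma>: "space \<Gamma> = geodesics" using \<Gamma> by (simp add: borel_prob_measures_def)
  have t01: "t \<in> {0..1}" using t by simp
  have "second_countable (geodesics_topology :: (real \<Rightarrow> 'a) topology)"
    using separable_geodesics Geo.sub.separable_imp_second_countable by (simp add: geodesics_topology_eq)
  note supp = msupport_complement_null[OF \<Gamma> this, folded G_def]
  have G_sets: "G \<in> sets \<Gamma>" by (rule borel_prob_measures_closedin[OF \<Gamma> supp(1)])
  have "AE c in \<Gamma>. c \<in> G"
    using AE_not_in[OF supp(2)] AE_space by eventually_elim (simp add: space_\<Gamma>)
  then have G1: "emeasure \<Gamma> G = 1" by (rule \<Gamma>.emeasure_eq_1_AE[OF G_sets])
  define A where "A = evl t ` G"
  obtain B B' where B: "B \<in> sets borel" "B' \<in> sets borel" "B \<subseteq> A" "A \<subseteq> B'"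
      "B' - B \<in> null_sets (distr (\<Gamma> \<Otimes>\<^sub>M unit_lborel) borel (\<lambda>(c, s). c s))"
    unfolding A_def
  proof (rule Metric_space.continuous_image_sandwich[OF geodesics_closed_subspace(1,2,4)[OF supp(1)]])
    show "continuous_map (Metric_space.mtopology G (mdist path_metric)) euclidean (evl t :: _ \<Rightarrow> 'a)"
      unfolding geodesics_closed_subspace(3)[OF supp(1)]
      by (rule continuous_map_from_subtopology[OF evl_continuous_map[OF t01]])
    show "finite_measure (distr (\<Gamma> \<Otimes>\<^sub>M unit_lborel) borel (\<lambda>(c, s). c s))"
      using P.P.prob_space_distr[OF evaluation_measurable[OF \<Gamma>]] by (simp add: prob_space_def)
    show "sets (distr (\<Gamma> \<Otimes>\<^sub>M unit_lborel) borel (\<lambda>(c, s). c s)) = sets borel" by simp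
  qed (rule that[unfolded A_def]; assumption)
  define J where "J \<epsilon> = {t - \<epsilon><..<t + \<epsilon>}" for \<epsilon>
  have J: "J \<epsilon> \<in> sets borel" "J \<epsilon> \<in> lmeasurable" for \<epsilon> by (simp_all add: J_def)
  have mJ: "measure lebesgue (J \<epsilon>) = 2 * \<epsilon>" "emeasure lborel (J \<epsilon>) = ennreal (2 * \<epsilon>)" if "\<epsilon> > 0" for \<epsilon>
    using that by (simp_all add: J_def)
  define F where "F \<epsilon> c = measure lebesgue (hit_times t G c \<inter> J \<epsilon>)" for \<epsilon> c
  define h where "h S \<epsilon> c = measure lborel (visit_times S c \<inter> J \<epsilon>)" for S :: "'a set" and \<epsilon> c
  have h_meas: "h S \<epsilon> \<in> borel_measurable \<Gamma>" if "S \<in> sets borel" for S \<epsilon>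
    unfolding h_def measure_def
    by (rule borel_measurable_enn2real[OF emeasure_visit_times_measurable[OF \<Gamma> that J(1)]])
  have "AE c in \<Gamma>. visit_times A c \<in> sets lebesgue \<and>
    (\<forall>J \<in> sets borel. measure lebesgue (visit_times A c \<inter> J) = measure lborel (visit_times B c \<inter> J))"
    by (rule visit_times_sandwich[OF \<Gamma> B])
  then have AE_F: "AE c in \<Gamma>. visit_times A c \<in> sets lebesgue \<and> F \<epsilon> c = h B \<epsilon> c" for \<epsilon>
    by eventually_elim (simp add: F_def h_def hit_times_eq_visit_times A_def J)
  have F_meas: "F \<epsilon> \<in> borel_measurable (completion \<Gamma>)" for \<epsilon>
  proof (rule measurable_completion_AE[OF h_meas[OF B(1)]])
    show "AE c in \<Gamma>. F \<epsilon> c = h B \<epsilon> c" using AE_F[of \<epsilon>] by eventually_elim simp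
  qed
  have bound: "measure lebesgue (S \<inter> J \<epsilon>) \<le> 2 * \<epsilon>" if "\<epsilon> > 0" for S \<epsilon>
  proof (cases "S \<inter> J \<epsilon> \<in> sets lebesgue")
    case True
    then have "measure lebesgue (S \<inter> J \<epsilon>) \<le> measure lebesgue (J \<epsilon>)"
      by (intro measure_mono_fmeasurable J) auto
    then show ?thesis using mJ that by simp
  qed (use that in \<open>simp add: measure_notin_sets\<close>)
  have F01: "0 \<le> F \<epsilon> c / (2 * \<epsilon>)" "F \<epsilon> c / (2 * \<epsilon>) \<le> 1" if "\<epsilon> > 0" for \<epsilon> c
    using bound[OF that, of "hit_times t G c"] that by (simp_all add: F_def)
  have int_G: "integrable (completion \<Gamma>) (\<lambda>c. indicator G c *\<^sub>R f c)"
    if f: "f \<in> borel_measurable (completion \<Gamma>)" "\<And>c. \<bar>f c\<bar> \<le> 1" for f :: "(real \<Rightarrow> 'a) \<Rightarrow> real"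
  proof (rule C\<Gamma>.integrable_const_bound[where B = 1])
    show "AE c in completion \<Gamma>. norm (indicator G c *\<^sub>R f c) \<le> 1"
      using f(2) by (intro AE_I2) (simp add: indicator_def)
    show "(\<lambda>c. indicator G c *\<^sub>R f c) \<in> borel_measurable (completion \<Gamma>)"
      by (intro borel_measurable_scaleR borel_measurable_indicator sets_completionI_sets G_sets f(1))
  qed
  have int_F: "integrable (completion \<Gamma>) (\<lambda>c. indicator G c *\<^sub>R (F \<epsilon> c / (2 * \<epsilon>)))" if "\<epsilon> > 0" for \<epsilon>
  proof (rule int_G)
    show "\<bar>F \<epsilon> c / (2 * \<epsilon>)\<bar> \<le> 1" for c using F01[OF that, of c] by linarith
  qed (use F_meas[of \<epsilon>] in measurable)
  define D where "D \<epsilon> = (LINT c:G|completion \<Gamma>. \<bar>F \<epsilon> c / (2 * \<epsilon>) - 1\<bar>)" for \<epsilon>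
  have D_nonneg: "0 \<le> D \<epsilon>" for \<epsilon>
    unfolding D_def set_lebesgue_integral_def by (intro integral_nonneg_AE) auto
  obtain \<eta> where \<eta>: "\<eta> > 0" "ball t \<eta> \<subseteq> U"
    using U_nbhd(2) unfolding mem_interior by blast
  have dens: "emeasure (distr \<Gamma> borel (evl s)) S \<le> ennreal C * emeasure m S"
    if s: "s \<in> {0..1}" "\<bar>s - t\<bar> < \<eta>" and S: "S \<in> sets borel" for s S
  proof -
    have sU: "s \<in> U" using \<eta>(2) s(2) by (auto simp: dist_real_def abs_minus_commute subset_iff)
    have "emeasure (distr \<Gamma> borel (evl s)) S = (\<integral>\<^sup>+ x. \<rho> s x * indicator S x \<partial>m)"
      using rho_measurable[OF sU] S by (simp add: marg[OF s(1)] rho_density[OF sU] emeasure_density m_borel)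
    also have "\<dots> \<le> (\<integral>\<^sup>+ x. ennreal C * indicator S x \<partial>m)"
      using rho_bound[OF sU] by (intro nn_integral_mono_AE) (auto elim!: eventually_mono split: split_indicator)
    also have "\<dots> = ennreal C * emeasure m S"
      using S by (simp add: nn_integral_cmult_indicator m_borel)
    finally show ?thesis .
  qed
  \<comment> \<open>the compact set \<open>K \<subseteq> A\<close> replaces \<open>A\<close>, as its visit times are Borel and its mass is controlled near \<open>t\<close>\<close>
  have D_small: "eventually (\<lambda>\<epsilon>. D \<epsilon> \<le> 1 - a) (at_right 0)" if a: "0 \<le> a" "a < 1" for a
  proof -
    obtain K \<delta> where K: "compact K" "K \<subseteq> evl t ` G" "\<delta> > 0"
      "\<And>s. s \<in> {0..1} \<Longrightarrow> \<bar>s - t\<bar> < \<delta> \<Longrightarrow> a \<le> measure (distr \<Gamma> borel (evl s)) K"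
      by (rule evaluation_image_mass_continuity[OF m_borel m_compact_finite \<Gamma> supp(1) G1 t01 \<eta>(1) dens a])
        (assumption | rule that)+
    have K_borel: "K \<in> sets borel" by (rule borel_compact[OF K(1)])
    have "D \<epsilon> \<le> 1 - a" if \<epsilon>: "0 < \<epsilon>" "\<epsilon> < min \<delta> (min t (1 - t))" for \<epsilon>
    proof -
      have J01: "J \<epsilon> \<subseteq> {0..1}" using \<epsilon> by (auto simp: J_def)
      have hK: "emeasure lborel (visit_times K c \<inter> J \<epsilon>) = ennreal (h K \<epsilon> c)" for c
      proof -
        have "emeasure lborel (visit_times K c \<inter> J \<epsilon>) \<le> emeasure lborel (J \<epsilon>)"
          using J(1) by (intro emeasure_mono) auto
        then show ?thesis
          unfolding h_def using mJ(2)[OF \<epsilon>(1)]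
          by (intro emeasure_eq_ennreal_measure) (auto simp: top_unique)
      qed
      have vK: "visit_times K c \<inter> J \<epsilon> \<in> sets lborel" if "c \<in> space \<Gamma>" for c
        using visit_times_sets[OF \<Gamma> that K_borel] J(1) by simp
      have h_leb: "h K \<epsilon> c = measure lebesgue (visit_times K c \<inter> J \<epsilon>)" if "c \<in> space \<Gamma>" for c
        unfolding h_def using vK[OF that] by simp
      have h_int: "integrable \<Gamma> (h K \<epsilon>)"
        using bound[OF \<epsilon>(1)] h_leb h_meas[OF K_borel]
        by (intro \<Gamma>.integrable_const_bound[where B = "2 * \<epsilon>"] AE_I2) auto
      have "ennreal a * emeasure lborel (J \<epsilon>) \<le> (\<integral>\<^sup>+ c. emeasure lborel (visit_times K c \<inter> J \<epsilon>) \<partial>\<Gamma>)"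
      proof (rule nn_integral_visit_times[OF \<Gamma> K_borel J(1) J01])
        fix s assume s: "s \<in> J \<epsilon>"
        then have s01: "s \<in> {0..1}" using J01 by blast
        have "evl s \<in> borel_measurable \<Gamma>"
          by (intro borel_prob_measures_continuous_map[OF \<Gamma>] evl_continuous_map s01)
        then interpret N: prob_space "distr \<Gamma> borel (evl s)" by (rule \<Gamma>.prob_space_distr)
        have "\<bar>s - t\<bar> < \<delta>" using s \<epsilon> by (auto simp: J_def)
        then show "ennreal a \<le> emeasure (distr \<Gamma> borel (evl s)) K"
          using K(4)[OF s01] by (simp add: N.emeasure_eq_measure)
      qed
      also have "\<dots> = (\<integral>\<^sup>+ c. ennreal (h K \<epsilon> c) \<partial>\<Gamma>)" by (simp only: hK)
      also have "\<dots> = ennreal (\<integral>c. h K \<epsilon> c \<partial>\<Gamma>)"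
        by (rule nn_integral_eq_integral[OF h_int]) (simp add: h_def)
      finally have "ennreal (a * (2 * \<epsilon>)) \<le> ennreal (\<integral>c. h K \<epsilon> c \<partial>\<Gamma>)"
        using a \<epsilon> by (simp add: mJ(2) ennreal_mult[symmetric])
      moreover have "0 \<le> (\<integral>c. h K \<epsilon> c \<partial>\<Gamma>)" by (intro integral_nonneg_AE) (simp add: h_def)
      ultimately have occupation: "a * (2 * \<epsilon>) \<le> (\<integral>c. h K \<epsilon> c \<partial>\<Gamma>)"
        by (simp only: ennreal_le_iff)
      have "AE c in \<Gamma>. h K \<epsilon> c \<le> F \<epsilon> c"
        using AE_F[of \<epsilon>] AE_space
      proof eventually_elim
        case (elim c)
        have "visit_times K c \<inter> J \<epsilon> \<subseteq> visit_times A c \<inter> J \<epsilon>"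
          using K(2) by (auto simp: visit_times_def A_def)
        moreover have "visit_times A c \<inter> J \<epsilon> \<in> lmeasurable"
          using elim(1) J(1) by (intro fmeasurableI2[OF J(2)]) auto
        ultimately have "measure lebesgue (visit_times K c \<inter> J \<epsilon>) \<le> measure lebesgue (visit_times A c \<inter> J \<epsilon>)"
          using vK[OF elim(2)] by (intro measure_mono_fmeasurable) auto
        then show ?case using h_leb[OF elim(2)] by (simp add: F_def hit_times_eq_visit_times A_def)
      qed
      then have le: "AE c in completion \<Gamma>. indicator G c *\<^sub>R \<bar>F \<epsilon> c / (2 * \<epsilon>) - 1\<bar> \<le> 1 - h K \<epsilon> c / (2 * \<epsilon>)"
      proof (intro AE_completion, eventually_elim)
        case (elim c)
        have "h K \<epsilon> c / (2 * \<epsilon>) \<le> F \<epsilon> c / (2 * \<epsilon>)"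
          using elim \<epsilon> by (intro divide_right_mono) auto
        then show ?case using F01[OF \<epsilon>(1), of c] by (auto split: split_indicator)
      qed
      have int_abs: "integrable (completion \<Gamma>) (\<lambda>c. indicator G c *\<^sub>R \<bar>F \<epsilon> c / (2 * \<epsilon>) - 1\<bar>)"
      proof (rule int_G)
        show "\<bar>\<bar>F \<epsilon> c / (2 * \<epsilon>) - 1\<bar>\<bar> \<le> 1" for c using F01[OF \<epsilon>(1), of c] by linarith
      qed (use F_meas[of \<epsilon>] in measurable)
      have int_h: "integrable \<Gamma> (\<lambda>c. 1 - h K \<epsilon> c / (2 * \<epsilon>))" using h_int by simp
      have "D \<epsilon> \<le> (\<integral>c. 1 - h K \<epsilon> c / (2 * \<epsilon>) \<partial>completion \<Gamma>)"
        unfolding D_def set_lebesgue_integral_def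
        using int_h by (intro integral_mono_AE int_abs le) (simp add: integrable_completion)
      also have "\<dots> = (\<integral>c. 1 - h K \<epsilon> c / (2 * \<epsilon>) \<partial>\<Gamma>)"
        using int_h by (intro integral_completion) auto
      also have "\<dots> = 1 - (\<integral>c. h K \<epsilon> c \<partial>\<Gamma>) / (2 * \<epsilon>)"
        using h_int by (simp add: \<Gamma>.prob_space)
      also have "\<dots> \<le> 1 - a"
        using occupation \<epsilon> by (simp add: pos_le_divide_eq)
      finally show ?thesis .
    qed
    moreover have "eventually (\<lambda>\<epsilon>. 0 < \<epsilon> \<and> \<epsilon> < min \<delta> (min t (1 - t))) (at_right 0)"
      using K(3) t by (intro eventually_conj eventually_at_right_less order_tendstoD(2)[OF tendsto_ident_at]) auto
    ultimately show ?thesis by (auto elim!: eventually_mono)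
  qed
  have "(D \<longlongrightarrow> 0) (at_right 0)"
  proof (rule tendstoI)
    fix e :: real assume "e > 0"
    then have "eventually (\<lambda>\<epsilon>. D \<epsilon> \<le> 1 - max 0 (1 - e / 2)) (at_right 0)"
      by (intro D_small) auto
    then show "eventually (\<lambda>\<epsilon>. dist (D \<epsilon>) 0 < e) (at_right 0)"
      by eventually_elim (use D_nonneg \<open>e > 0\<close> in \<open>auto simp: max_def split: if_splits\<close>)
  qed
  then show ?thesis
    using int_F unfolding D_def F_def J_def set_integrable_def by blast
qed

end
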